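(* Let $\mathcal{C}$ be a covering of the plane by complete folding curves, satisfying the local isomorphism property, which is generated by a curve associated to the $\infty$-folding sequence $(a_k)_{k\in\mathbb{N}^*}$ with $a_{2^{4n}}=a_{2^{4n+1}}=+1$ and $a_{2^{4n+2}}=a_{2^{4n+3}}=-1$ for each $n\in\mathbb{N}$. Then $\mathcal{C}$ is locally isomorphic to a covering by $4$ curves.
   Context: Curves and coverings. Identify $\mathbb{R}^2$ with $\mathbb{C}$ and $\mathbb{Z}^2$ with $\mathbb{Z}+i\mathbb{Z}$. To a sequence $(a_k)_{1\le k\le n-1}$, $(a_k)_{k\in\mathbb{N}^*}$ or $(a_k)_{k\in\mathbb{Z}}$ with all $a_k=\pm1$ are associated the curves $(C_k)_{1\le k\le n}$, $(C_k)_{k\in\mathbb{N}^*}$, $(C_k)_{k\in\mathbb{Z}}$ whose segments are oriented intervals $C_k=[x_k,x_k+\varepsilon_k]$ with $x_k\in\mathbb{Z}+i\mathbb{Z}$, $\varepsilon_k\in\{1,-1,i,-i\}$, and, whenever $C_k,C_{k+1}$ exist, $x_k+\varepsilon_k=x_{k+1}$ and $\varepsilon_{k+1}=i^{a_k}\varepsilon_k$. Curves are rounded at the points $x_{k+1}$ so that they do not pass through them (so curves sharing no unit interval are disjoint). Curves indexed by $\mathbb{Z}$ are called complete and are considered up to a shift of the index. A covering (of the plane) is a set of complete curves such that each nonoriented interval $[z,z+\varepsilon]$ with $z\in\mathbb{Z}+i\mathbb{Z}$, $\varepsilon\in\{1,i\}$ is the support of exactly one segment of exactly one of the curves. Orientation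 convention: for each $z=x+iy\in\mathbb{Z}+i\mathbb{Z}$, depending on the parity of $x+y$, the segments with endpoint $z$ are $[z,z+1],[z,z-1],[z+i,z],[z-i,z]$, or they are $[z+1,z],[z-1,z],[z,z+i],[z,z-i]$. Folding sequences. For a finite sequence $S=(a_1,\dots,a_m)$ put $\overline{S}=(-a_m,\dots,-a_1)$. The $0$-folding sequence is empty, and the $(n+1)$-folding sequences are the sequences $(\overline{S},\varepsilon,S)$ with $S$ an $n$-folding sequence and $\varepsilon=\pm1$. An $\infty$-folding sequence is a sequence $S=(a_k)_{k\in\mathbb{N}^*}$ such that $(a_1,\dots,a_{2^n-1})$ is an $n$-folding sequence for every $n$; it is determined by the values $a_{2^n}$, $n\in\mathbb{N}$, which can be arbitrary. A complete folding sequence is a sequence $(a_k)_{k\in\mathbb{Z}}$ in $\{\pm1\}$ such that each finite block $(a_{k+1},\dots,a_{k+l})$ is a block of consecutive terms of an $n$-folding sequence for some $n$. $\infty$-folding curves and complete folding curves are the curves associated to such sequences. Local isomorphism. For sets of curves $\mathcal{B},\mathcal{C}$: $\mathcal{B}\cong\mathcal{C}$ means that $\mathcal{C}$ is the image of $\mathcal{B}$ under a translation; $\mathcal{B}<\mathcal{C}$ means that $\mathcal{B}\ne\mathcal{C}$, each curve of $\mathcal{B}$ is contained in (is a subcurve of) a curve of $\mathcal{C}$, and any consecutive segments of a curve of $\mathcal{C}$ which belong to curves of $\mathcal{B}$ are consecutive in one of them. A covering $\mathcal{C}$ satisfies the local isomorphism property if for each bounded set of curves (finitely many segments) $\mathcal{B}<\mathcal{C}$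 there is $r>0$ such that every disc of radius $r$ contains some $\mathcal{B}'<\mathcal{C}$ with $\mathcal{B}'\cong\mathcal{B}$. Coverings $\mathcal{C},\mathcal{D}$ are locally isomorphic if for each bounded $\mathcal{B}<\mathcal{C}$ there is $\mathcal{B}'<\mathcal{D}$ with $\mathcal{B}'\cong\mathcal{B}$, and conversely with $\mathcal{C}$ and $\mathcal{D}$ exchanged. Generation. A covering $\mathcal{C}$ by complete folding curves which satisfies the local isomorphism property is generated by an $\infty$-folding curve $D$ with initial point $x$ if, up to reversal of orientation, the four curves obtained from $D$ by the rotations of angles $0,\pi/2,\pi,3\pi/2$ around $x$ are subcurves of curves of $\mathcal{C}$ (they are then connected at $x$ into two complete curves of $\mathcal{C}$). *)

theory Defs
  imports "HOL-Analysis.Analysis" "HOL-Library.Sublist"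
begin

section \<open>Segments and curves\<close>

text \<open>The pair \<open>(x, \<epsilon>)\<close> stands for the oriented interval \<open>[x, x + \<epsilon>]\<close>.\<close>

type_synonym seg = "complex \<times> complex"

definition gauss_int :: "complex set" where
  "gauss_int = {z. Re z \<in> \<int> \<and> Im z \<in> \<int>}"

definition is_seg :: "seg \<Rightarrow> bool" where
  "is_seg s \<longleftrightarrow> fst s \<in> gauss_int \<and> snd s \<in> {1, -1, \<i>, -\<i>}"

definition supp :: "seg \<Rightarrow> complex set" where
  "supp s = closed_segment (fst s) (fst s + snd s)"

definition rev_seg :: "seg \<Rightarrow> seg" where
  "rev_seg s = (fst s + snd s, - snd s)"

definition translate_seg :: "complex \<Rightarrow> seg \<Rightarrow> seg" where
  "translate_seg t s = (fst s + t, snd s)"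

text \<open>Rotation around \<open>p\<close>, where \<open>u\<close> is a complex number of modulus 1.\<close>

definition rotate_seg :: "complex \<Rightarrow> complex \<Rightarrow> seg \<Rightarrow> seg" where
  "rotate_seg p u s = (p + u * (fst s - p), u * snd s)"

text \<open>
  The family \<open>(c k)\<close>, \<open>k \<in> J\<close>, is a curve associated to the sequence \<open>a\<close>. Only the values
  \<open>c k\<close> with \<open>k \<in> J\<close> and \<open>a k\<close> with \<open>k, k + 1 \<in> J\<close> matter; \<open>J\<close> is \<open>{1..}\<close> or \<open>UNIV\<close> below.
  The rounding of a curve at its vertices is not recorded: the way in which the
  segments are joined is given by the indexing.
\<close>

definition curve_assoc :: "int set \<Rightarrow> (int \<Rightarrow> int) \<Rightarrow> (int \<Rightarrow> seg) \<Rightarrow> bool" where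
  "curve_assoc J a c \<longleftrightarrow>
     (\<forall>k\<in>J. is_seg (c k)) \<and>
     (\<forall>k\<in>J. k + 1 \<in> J \<longrightarrow>
        a k \<in> {1, -1} \<and>
        fst (c k) + snd (c k) = fst (c (k + 1)) \<and>
        snd (c (k + 1)) = \<i> powi (a k) * snd (c k))"

text \<open>A complete curve is an equivalence class of indexed curves modulo shift of the index.\<close>

definition shift_rel :: "((int \<Rightarrow> seg) \<times> (int \<Rightarrow> seg)) set" where
  "shift_rel = {(c, d). \<exists>m. \<forall>k. d k = c (k + m)}"

lemma equiv_shift_rel: "equiv UNIV shift_rel"
proof (rule equivI)
  show "shift_rel \<subseteq> UNIV \<times> UNIV" by simp
  show "refl shift_rel"
    unfolding shift_rel_def refl_on_def by (auto intro: exI[of _ 0])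
  show "sym shift_rel"
  proof (rule symI)
    fix c d assume "(c, d) \<in> shift_rel"
    then obtain m where "\<forall>k. d k = c (k + m)" by (auto simp: shift_rel_def)
    then have "\<forall>k. c k = d (k + (- m))" by simp
    then show "(d, c) \<in> shift_rel" unfolding shift_rel_def by blast
  qed
  show "trans shift_rel"
  proof (rule transI)
    fix c d e assume "(c, d) \<in> shift_rel" "(d, e) \<in> shift_rel"
    then obtain m n where "\<forall>k. d k = c (k + m)" "\<forall>k. e k = d (k + n)"
      unfolding shift_rel_def by blast
    then have "\<forall>k. e k = c (k + (n + m))" by (simp add: add.assoc)
    then show "(c, e) \<in> shift_rel" unfolding shift_rel_def by blast
  qed
qed

type_synonym ccurve = "(int \<Rightarrow> seg) set"

definition complete_curves :: "ccurve set" where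
  "complete_curves = {c. \<exists>a. curve_assoc UNIV a c} // shift_rel"


section \<open>Coverings of the plane\<close>

definition segs_of :: "ccurve set \<Rightarrow> seg set" where
  "segs_of \<C> = {c k | c k K. K \<in> \<C> \<and> c \<in> K}"

definition segs_at :: "ccurve set \<Rightarrow> complex \<Rightarrow> seg set" where
  "segs_at \<C> z = {s \<in> segs_of \<C>. fst s = z \<or> fst s + snd s = z}"

definition orientation_convention :: "ccurve set \<Rightarrow> bool" where
  "orientation_convention \<C> \<longleftrightarrow>
     (\<exists>p. \<forall>x y :: int. let z = Complex (of_int x) (of_int y) in
        segs_at \<C> z =
          (if even (x + y) = p
           then {(z, 1), (z, -1), (z + \<i>, -\<i>), (z - \<i>, \<i>)}
           else {(z + 1, -1), (z - 1, 1), (z, \<i>), (z, -\<i>)}))"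

text \<open>
  ``Exactly one segment'' counts indices: a closed path, run through infinitely often by a
  periodic indexed curve, does not belong to a covering.
\<close>

definition covering :: "ccurve set \<Rightarrow> bool" where
  "covering \<C> \<longleftrightarrow>
     \<C> \<subseteq> complete_curves \<and>
     (\<forall>z\<in>gauss_int. \<forall>\<epsilon>\<in>{1, \<i>}.
        \<exists>K\<in>\<C>. (\<forall>c\<in>K. \<exists>!k. supp (c k) = supp (z, \<epsilon>)) \<and>
          (\<forall>L\<in>\<C>. L \<noteq> K \<longrightarrow> (\<forall>c\<in>L. \<forall>k. supp (c k) \<noteq> supp (z, \<epsilon>)))) \<and>
     orientation_convention \<C>"


section \<open>Folding sequences\<close>

definition bar :: "int list \<Rightarrow> int list" where
  "bar S = rev (map uminus S)"

primrec folding_seqs :: "nat \<Rightarrow> int list set" where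
  "folding_seqs 0 = {[]}"
| "folding_seqs (Suc n) = {bar S @ [e] @ S | S e. S \<in> folding_seqs n \<and> e \<in> {1, -1}}"

text \<open>Only the values \<open>a k\<close> with \<open>k \<ge> 1\<close> matter in the next definition.\<close>

definition infty_folding_seq :: "(int \<Rightarrow> int) \<Rightarrow> bool" where
  "infty_folding_seq a \<longleftrightarrow> (\<forall>n::nat. map a [1..2 ^ n - 1] \<in> folding_seqs n)"

definition complete_folding_seq :: "(int \<Rightarrow> int) \<Rightarrow> bool" where
  "complete_folding_seq a \<longleftrightarrow>
     (\<forall>k. a k \<in> {1, -1}) \<and>
     (\<forall>k. \<forall>l::nat. \<exists>n. \<exists>S\<in>folding_seqs n. sublist (map a [k + 1..k + int l]) S)"

definition complete_folding_curve :: "ccurve \<Rightarrow> bool" where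
  "complete_folding_curve K \<longleftrightarrow>
     K \<in> complete_curves \<and> (\<exists>c\<in>K. \<exists>a. complete_folding_seq a \<and> curve_assoc UNIV a c)"


section \<open>Local isomorphism\<close>

text \<open>
  A bounded set of curves is a finite set of finite curves, each given as the nonempty list of
  its consecutive segments. Such a set is never equal to a set of complete curves, so the
  condition \<open>\<B> \<noteq> \<C>\<close> in the definition of \<open>\<B> < \<C>\<close> holds automatically.
\<close>

definition finite_subcurve :: "seg list \<Rightarrow> ccurve \<Rightarrow> bool" where
  "finite_subcurve b K \<longleftrightarrow> b \<noteq> [] \<and> (\<exists>c\<in>K. \<exists>m n. b = map c [m..n])"

definition bounded_below :: "seg list set \<Rightarrow> ccurve set \<Rightarrow> bool" where
  "bounded_below \<B> \<C> \<longleftrightarrow>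
     finite \<B> \<and>
     (\<forall>b\<in>\<B>. \<exists>K\<in>\<C>. finite_subcurve b K) \<and>
     (\<forall>K\<in>\<C>. \<forall>s. finite_subcurve s K \<and> set s \<subseteq> (\<Union>b\<in>\<B>. set b) \<longrightarrow> (\<exists>b\<in>\<B>. sublist s b))"

definition translate_of :: "seg list set \<Rightarrow> seg list set \<Rightarrow> bool" where
  "translate_of \<B> \<B>' \<longleftrightarrow> (\<exists>t. \<B>' = map (translate_seg t) ` \<B>)"

definition local_isomorphism_property :: "ccurve set \<Rightarrow> bool" where
  "local_isomorphism_property \<C> \<longleftrightarrow>
     (\<forall>\<B>. bounded_below \<B> \<C> \<longrightarrow>
        (\<exists>r>0. \<forall>z. \<exists>\<B>'. bounded_below \<B>' \<C> \<and> translate_of \<B> \<B>' \<and>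
           (\<forall>b\<in>\<B>'. \<forall>s\<in>set b. supp s \<subseteq> cball z r)))"

definition locally_isomorphic :: "ccurve set \<Rightarrow> ccurve set \<Rightarrow> bool" where
  "locally_isomorphic \<C> \<D> \<longleftrightarrow>
     (\<forall>\<B>. bounded_below \<B> \<C> \<longrightarrow> (\<exists>\<B>'. bounded_below \<B>' \<D> \<and> translate_of \<B> \<B>')) \<and>
     (\<forall>\<B>. bounded_below \<B> \<D> \<longrightarrow> (\<exists>\<B>'. bounded_below \<B>' \<C> \<and> translate_of \<B> \<B>'))"


section \<open>Generation of a covering\<close>

text \<open>
  Here \<open>D\<close> is a curve indexed by \<open>{1..}\<close>. As \<open>K\<close> is closed under shifts of the
  index, it suffices to compare \<open>D\<close> with a representative indexed in the same way. The second
  alternative says that the curve obtained from \<open>D\<close> by reversal of orientation is a subcurve.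
\<close>

definition infinite_subcurve_up_to_reversal :: "(int \<Rightarrow> seg) \<Rightarrow> ccurve \<Rightarrow> bool" where
  "infinite_subcurve_up_to_reversal D K \<longleftrightarrow>
     (\<exists>c\<in>K. (\<forall>k\<ge>1. c k = D k) \<or> (\<forall>k\<ge>1. c (- k) = rev_seg (D k)))"

definition generated_by :: "ccurve set \<Rightarrow> (int \<Rightarrow> seg) \<Rightarrow> bool" where
  "generated_by \<C> D \<longleftrightarrow>
     (\<forall>u\<in>{1, \<i>, -1, -\<i>}. \<exists>K\<in>\<C>.
        infinite_subcurve_up_to_reversal (\<lambda>k. rotate_seg (fst (D 1)) u (D k)) K)"

end

theory Submission
  imports Defs
begin

text \<open>
  Up to a similarity, the covering generated by \<open>D\<close> is given by an explicit function
  \<open>\<sigma>\<close> on the nonzero Gaussian integers, the turn made by the curves at each vertex. If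
  \<open>z = \<beta>\<^sub>n w\<close> with \<open>w\<close> not divisible by \<open>1 + i\<close>, where
  \<open>\<beta>\<^sub>n = (1 - e\<^sub>0 i) \<dots> (1 - e\<^sub>n\<^sub>-\<^sub>1 i)\<close> and \<open>e\<^sub>n = - a(2\<^sup>n)\<close>, then
  \<open>\<sigma>(z) = e\<^sub>n (-1)\<close> to the power \<open>Re w\<close>. As \<open>e = -, -, +, +\<close> has period 4 and
  \<open>\<beta>\<^sub>4 = 4\<close>, we have \<open>\<sigma>(4z) = \<sigma>(z)\<close>, and also \<open>\<sigma>(3z) = \<sigma>(z)\<close>. The covering with four curves
  has the turn \<open>\<sigma>(3z + 1)\<close> at \<open>z\<close>: it is a limit of translates of the given covering, because
  \<open>-1/3\<close> is a limit of integers in the \<open>(1 + i)\<close>-adic topology, so the two coverings have the same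
  finite patterns.

  Curves are analysed by unfolding: two consecutive segments of a curve form one segment of a curve
  of the next level, in the coordinates obtained by division by \<open>1 - e\<^sub>n i\<close>. Four levels at a time, this
  map contracts the plane and acts on a fixed system. Hence each segment ends up in a finite set of
  segments that are fixed by four steps, and a finite computation shows that there are four of
  them, in both systems. Since the map halves the distance between segments along a curve, distinct fixed
  segments that are not consecutive lie on distinct curves, and no curve is closed.
\<close>

section \<open>The turn at a vertex\<close>

text \<open>The pair \<open>((x, y), (a, b))\<close> is the segment from \<open>x + iy\<close> with direction \<open>a + ib\<close>.\<close>

type_synonym edge = "(int \<times> int) \<times> (int \<times> int)"

definition level_sign :: "nat \<Rightarrow> int" where
  "level_sign n = (if n mod 4 < 2 then -1 else 1)"

lemma level_sign_cases: "level_sign n = 1 \<or> level_sign n = -1"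
  by (simp add: level_sign_def)

lemma level_sign_add4 [simp]: "level_sign (n + 4) = level_sign n"
  by (simp add: level_sign_def)

text \<open>Division by 1 - e i halves the norm, because |1 - e i|^2 = 2. This makes the recursion
  of \<open>turn\<close> terminate.\<close>

lemma norm_div_1_plus_i:
  fixes x y e :: int
  assumes "even (x + y)" "e = 1 \<or> e = -1"
  shows "2 * (((x - e * y) div 2)\<^sup>2 + ((y + e * x) div 2)\<^sup>2) = x\<^sup>2 + y\<^sup>2"
proof -
  define u v where "u = (x - e * y) div 2" and "v = (y + e * x) div 2"
  have "even (x - e * y)" "even (y + e * x)" using assms by auto
  then have "2 * u = x - e * y" "2 * v = y + e * x" by (auto simp: u_def v_def)
  then have "(2 * u)\<^sup>2 + (2 * v)\<^sup>2 = 2 * (x\<^sup>2 + y\<^sup>2)"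
    using assms(2) by (auto simp: power2_eq_square algebra_simps)
  then show ?thesis by (simp add: u_def v_def power_mult_distrib)
qed

text \<open>
  The turn at \<open>x + iy\<close> of the curves of level \<open>n\<close>; the third case divides by \<open>1 - e\<^sub>n i\<close>.
  The value at \<open>0\<close> is arbitrary.
\<close>

function turn :: "nat \<Rightarrow> int \<Rightarrow> int \<Rightarrow> int" where
  "turn n x y =
     (if x = 0 \<and> y = 0 then 1
      else if odd (x + y) then (if even x then level_sign n else - level_sign n)
      else turn (Suc n) ((x - level_sign n * y) div 2) ((y + level_sign n * x) div 2))"
  by auto
termination
proof (relation "Wellfounded.measure (\<lambda>(n, x, y). nat (x\<^sup>2 + y\<^sup>2))", goal_cases)
  case (2 n x y)
  have "2 * (((x - level_sign n * y) div 2)\<^sup>2 + ((y + level_sign n * x) div 2)\<^sup>2) = x\<^sup>2 + y\<^sup>2"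
    using 2 level_sign_cases by (intro norm_div_1_plus_i) auto
  moreover have "x\<^sup>2 + y\<^sup>2 > 0"
    using 2 by (simp add: sum_power2_gt_zero_iff)
  ultimately show ?case by simp
qed simp

declare turn.simps [simp del]

lemma turn_0 [simp]: "turn n 0 0 = 1"
  by (simp add: turn.simps)

lemma turn_odd: "odd (x + y) \<Longrightarrow> turn n x y = (if even x then level_sign n else - level_sign n)"
  by (subst turn.simps) auto

lemma turn_double: "turn n (x + level_sign n * y) (y - level_sign n * x) = turn (Suc n) x y"
proof (cases "x = 0 \<and> y = 0")
  case False
  have "(x + level_sign n * y - level_sign n * (y - level_sign n * x)) div 2 = x"
       "(y - level_sign n * x + level_sign n * (x + level_sign n * y)) div 2 = y"
    using level_sign_cases[of n] by auto
  moreover have "\<not> (x + level_sign n * y = 0 \<and>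
    y - level_sign n * x = 0)" "even (x + level_sign n * y + (y - level_sign n * x))"
    using False level_sign_cases[of n] by auto
  ultimately show ?thesis by (subst turn.simps) auto
qed auto

text \<open>Induction without \<open>div\<close>: a nonzero point with even coordinate sum is a
  multiple of 1 - e i, so the step goes from w to (1 - e i) w, where \<open>turn_double\<close>
  applies.\<close>

lemma turn_induct [case_names zero odd double]:
  assumes "\<And>n. P n 0 0"
    and "\<And>n x y. odd (x + y) \<Longrightarrow> P n x y"
    and "\<And>n u v. (u, v) \<noteq> (0, 0) \<Longrightarrow> P (Suc n) u v \<Longrightarrow> P n (u + level_sign n * v) (v - level_sign n * u)"
  shows "P n x y"
proof (induction n x y rule: turn.induct)
  case (1 n x y)
  show ?case
  proof (cases "odd (x + y) \<or> x = 0 \<and> y = 0")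
    case False
    define u v where "u = (x - level_sign n * y) div 2" and "v = (y + level_sign n * x) div 2"
    have "even (x - level_sign n * y)" "even (y + level_sign n * x)"
      using False level_sign_cases[of n] by auto
    then have "2 * u = x - level_sign n * y" "2 * v = y + level_sign n * x"
      by (simp_all add: u_def v_def)
    then have xy: "x = u + level_sign n * v" "y = v - level_sign n * u"
      using level_sign_cases[of n] by auto
    moreover have "P (Suc n) u v"
      using 1 False by (simp add: u_def v_def)
    moreover have "(u, v) \<noteq> (0, 0)"
      using xy False by auto
    ultimately show ?thesis using assms(3) by simp
  qed (use assms in auto)
qed

lemma odd_level_sign [simp]: "odd (level_sign n)"
  by (simp add: level_sign_def)

lemma turn_cases: "turn n x y = 1 \<or> turn n x y = -1"
proof (induction n x y rule: turn_induct)
  case (odd n x y)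
  then show ?case using level_sign_cases[of n] by (auto simp: turn_odd)
next
  case (double n u v)
  then show ?case by (simp add: turn_double)
qed simp

lemma turn_add4 [simp]: "turn (n + 4) x y = turn n x y"
proof (induction n x y rule: turn_induct)
  case (double n u v)
  have "turn (n + 4) (u + level_sign (n + 4) * v) (v - level_sign (n + 4) * u) = turn (Suc n + 4) u v"
    by (simp only: turn_double add_Suc)
  then show ?case using double by (simp only: turn_double level_sign_add4)
qed (auto simp: turn_odd)

lemma turn_neg: "turn n (- x) (- y) = turn n x y"
proof (induction n x y rule: turn_induct)
  case (double n u v)
  then show ?case using turn_double[of n u v] turn_double[of n "- u" "- v"] by simp
qed (auto simp: turn_odd)

text \<open>At a point with odd coordinate sum, multiplication by i exchanges the parities of the
  coordinates, and it commutes with the factors 1 - e i. The origin is excluded because its value is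
  a convention.\<close>

lemma turn_rot: "(x, y) \<noteq> (0, 0) \<Longrightarrow> turn n (- y) x = - turn n x y"
proof (induction n x y rule: turn_induct)
  case (double n u v)
  then show ?case using turn_double[of n u v] turn_double[of n "- v" u] by (simp add: algebra_simps)
qed (auto simp: turn_odd)

text \<open>An odd factor keeps both parities and commutes with the divisions by 1 - e i.\<close>

lemma turn_odd_mult:
  assumes "odd q" shows "turn n (q * x) (q * y) = turn n x y"
proof (induction n x y rule: turn_induct)
  case (odd n x y)
  then show ?case using assms by (auto simp: turn_odd)
next
  case (double n u v)
  then show ?case using turn_double[of n u v] turn_double[of n "q * u" "q * v"]
    by (simp add: algebra_simps)
qed auto

text \<open>The factors of levels 0 to 3 are 1 + i, 1 + i, 1 - i, 1 - i, with product 4, and level 4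
  has the signs of level 0 again.\<close>

lemma turn_mult4: "turn 0 (4 * x) (4 * y) = turn 0 x y"
proof -
  have "turn 0 x y = turn 4 x y" using turn_add4[of 0] by simp
  also have "4 = Suc (Suc (Suc (Suc 0)))" by simp
  also have "turn \<dots> x y = turn 0 (4 * x) (4 * y)"
    by (simp only: turn_double[symmetric]) (simp add: level_sign_def algebra_simps)
  finally show ?thesis by simp
qed

text \<open>Each division by 1 - e i halves the norm and costs the offset at most one power of 2, so
  the bound persists until the coordinate sum is odd. There the norm is at least 1, hence k > 0, and
  the even offset leaves the parities alone.\<close>

lemma turn_cong_pow2:
  assumes "(x, y) \<noteq> (0, 0)" "x\<^sup>2 + y\<^sup>2 < 2 ^ k"
  shows "turn n (x + 2 ^ k * a) (y + 2 ^ k * b) = turn n x y"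
  using assms
proof (induction n x y arbitrary: k a b rule: turn_induct)
  case (odd n x y)
  then have "x \<noteq> 0 \<or> y \<noteq> 0" by auto
  then have "0 < x\<^sup>2 + y\<^sup>2" by (simp add: sum_power2_gt_zero_iff)
  with odd have "k \<noteq> 0" by (intro notI) simp
  with odd show ?case by (auto simp: turn_odd)
next
  case (double n u v)
  have nz: "0 < u\<^sup>2 + v\<^sup>2" using double by (auto simp: sum_power2_gt_zero_iff)
  have eq: "(u + level_sign n * v)\<^sup>2 + (v - level_sign n * u)\<^sup>2 = 2 * (u\<^sup>2 + v\<^sup>2)"
    using level_sign_cases[of n] by (auto simp: power2_eq_square algebra_simps)
  have "k \<noteq> 0" using double nz eq by (intro notI) simp
  then obtain j where k: "k = Suc j" by (cases k) auto
  have "u\<^sup>2 + v\<^sup>2 < 2 ^ j" using double eq k by simp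
  then have "turn (Suc n) (u + 2 ^ j * (a - level_sign n * b)) (v + 2 ^ j * (b + level_sign n * a))
    = turn (Suc n) u v"
    using double by blast
  then show ?case
    using turn_double[of n u v]
      turn_double[of n "u + 2 ^ j * (a - level_sign n * b)"
        "v + 2 ^ j * (b + level_sign n * a)"] level_sign_cases[of n]
    by (auto simp: k algebra_simps)
qed auto

section \<open>Segments and unfolding\<close>

lemma edge_cases [case_names E]:
  obtains x y a b where "f = (((x, y), (a, b)) :: edge)"
  by (metis prod.collapse)

text \<open>Horizontal segments leave the even points, vertical ones leave the odd points.\<close>

fun is_edge :: "edge \<Rightarrow> bool" where
  "is_edge ((x, y), (a, b)) \<longleftrightarrow>
     (if even (x + y) then b = 0 \<and> (a = 1 \<or> a = -1) else a = 0 \<and> (b = 1 \<or> b = -1))"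

fun at_even :: "edge \<Rightarrow> bool" where
  "at_even ((x, y), d) \<longleftrightarrow> even (x + y)"

text \<open>In the next definitions \<open>q\<close> is the length of a segment with direction \<open>(a, b)\<close>.\<close>

fun nxt :: "int \<Rightarrow> (int \<Rightarrow> int \<Rightarrow> int) \<Rightarrow> edge \<Rightarrow> edge" where
  "nxt q t ((x, y), (a, b)) =
     ((x + q * a, y + q * b), (- t (x + q * a) (y + q * b) * b, t (x + q * a) (y + q * b) * a))"

fun prv :: "int \<Rightarrow> (int \<Rightarrow> int \<Rightarrow> int) \<Rightarrow> edge \<Rightarrow> edge" where
  "prv q t ((x, y), (a, b)) =
     ((x - q * (t x y * b), y + q * (t x y * a)), (t x y * b, - t x y * a))"

text \<open>
  The first of the two segments of level \<open>n\<close> of which a segment of level \<open>n + 1\<close> consists: its start is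
  multiplied by \<open>1 - e\<^sub>n i\<close>. It does not depend on the odd length \<open>q\<close>.
\<close>

fun child :: "nat \<Rightarrow> edge \<Rightarrow> edge" where
  "child n ((x, y), (a, b)) =
     ((x + level_sign n * y, y - level_sign n * x),
      if even (x + y) then (a, b) else (level_sign n * b, - level_sign n * a))"

fun parent_even :: "nat \<Rightarrow> edge \<Rightarrow> edge" where
  "parent_even n ((x, y), (a, b)) =
     (let u = (x - level_sign n * y) div 2; v = (y + level_sign n * x) div 2
      in ((u, v), if even (u + v) then (a, b) else (- level_sign n * b, level_sign n * a)))"

text \<open>A vertical segment is the second half of its parent; the turn at its start is known explicitly.\<close>

fun parent :: "int \<Rightarrow> nat \<Rightarrow> edge \<Rightarrow> edge" where
  "parent q n ((x, y), (a, b)) =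
     parent_even n (if even (x + y) then ((x, y), (a, b))
       else prv q (\<lambda>x y. if even x then level_sign n else - level_sign n) ((x, y), (a, b)))"

text \<open>Steps along a curve are invertible and respect the parity pattern as soon as the turns
  are 1 or -1 and the length is odd. The instances are \<open>turn n\<close> for odd q, and
  \<open>central_turn s\<close> and \<open>turn3\<close> for q = 1.\<close>

locale turning =
  fixes q :: int and t :: "int \<Rightarrow> int \<Rightarrow> int"
  assumes odd_q: "odd q" and t_cases: "t x y = 1 \<or> t x y = -1"
begin

lemma nxt_prv [simp]: "nxt q t (prv q t f) = f"
proof (cases f rule: edge_cases)
  case (E x y a b)
  then show ?thesis using t_cases[of x y] by auto
qed

lemma prv_nxt [simp]: "prv q t (nxt q t f) = f"
proof (cases f rule: edge_cases)
  case (E x y a b)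
  then show ?thesis using t_cases[of "x + q * a" "y + q * b"] by auto
qed

lemma is_edge_nxt: "is_edge f \<Longrightarrow> is_edge (nxt q t f)"
proof (cases f rule: edge_cases)
  case (E x y a b)
  then show "is_edge f \<Longrightarrow> is_edge (nxt q t f)"
    using t_cases[of "x + q * a" "y + q * b"] odd_q by (auto split: if_splits)
qed

lemma is_edge_prv: "is_edge f \<Longrightarrow> is_edge (prv q t f)"
proof (cases f rule: edge_cases)
  case (E x y a b)
  then show "is_edge f \<Longrightarrow> is_edge (prv q t f)"
    using t_cases[of x y] odd_q by (auto split: if_splits)
qed

lemma nxt_pow_inj: "(nxt q t ^^ k) f = (nxt q t ^^ k) g \<Longrightarrow> f = g"
  by (induction k) (auto dest: arg_cong[where f = "prv q t"])

lemma is_edge_pow: "is_edge f \<Longrightarrow> is_edge ((nxt q t ^^ k) f)"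
  by (induction k) (auto simp: is_edge_nxt)

lemma at_even_nxt: "is_edge f \<Longrightarrow> at_even (nxt q t f) \<longleftrightarrow> \<not> at_even f"
proof (cases f rule: edge_cases)
  case (E x y a b)
  then show "is_edge f \<Longrightarrow> ?thesis"
    using odd_q by (auto split: if_splits)
qed

lemma at_even_pow: "is_edge f \<Longrightarrow> at_even ((nxt q t ^^ j) f) \<longleftrightarrow> (even j \<longleftrightarrow> at_even f)"
  by (induction j) (auto simp: at_even_nxt is_edge_pow)

end

lemma turning_turn: "odd q \<Longrightarrow> turning q (turn n)"
  by unfold_locales (use turn_cases in auto)

abbreviation nx :: "int \<Rightarrow> nat \<Rightarrow> edge \<Rightarrow> edge" where
  "nx q n \<equiv> nxt q (turn n)"

section \<open>Segments, their halves and their parents\<close>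

lemma is_edge_child: "is_edge g \<Longrightarrow> is_edge (child n g)"
  by (cases g) (use level_sign_cases[of n] in \<open>auto split: if_splits\<close>)

text \<open>The midpoint has odd coordinate sum and odd first coordinate, so its turn is explicit.
  Up to the factor q the halves have directions a and - e i a, with sum (1 - e i) a, the image of
  the parent.\<close>

lemma nx_child_even:
  assumes "odd q" "even (x + y)" "a = 1 \<or> a = -1"
  shows "nx q n (child n ((x, y), (a, 0)))
    = ((x + level_sign n * y + q * a, y - level_sign n * x), (0, - level_sign n * a))"
proof -
  have "odd (x + level_sign n * y + q * a + (y - level_sign n * x))"
    using assms by auto
  then have "turn n (x + level_sign n * y + q * a) (y - level_sign n * x) = - level_sign n"
    using assms by (auto simp: turn_odd)
  then show ?thesis using assms by simp
qed

lemma nx_child_odd: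
  assumes "odd q" "odd (x + y)" "b = 1 \<or> b = -1"
  shows "nx q n (child n ((x, y), (0, b)))
    = ((x + level_sign n * y + q * (level_sign n * b), y - level_sign n * x), (0, b))"
proof -
  have "odd (x + level_sign n * y + q * (level_sign n * b) + (y - level_sign n * x))"
    using assms by auto
  then have "turn n (x + level_sign n * y + q * (level_sign n * b)) (y - level_sign n * x)
    = level_sign n"
    using assms by (auto simp: turn_odd)
  then show ?thesis using assms level_sign_cases[of n] by auto
qed

text \<open>The turn at the end of the parent is carried to its image by \<open>turn_double\<close>,
  and the turns at midpoints are explicit; so the path of the halves keeps following the path of the
  parents.\<close>

lemma child_nxt:
  assumes "odd q" "is_edge g"
  shows "child n (nx q (Suc n) g) = nx q n (nx q n (child n g))"
proof -
  obtain x y a b where g: "g = ((x, y), (a, b))" by (rule edge_cases)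
  show ?thesis
  proof (cases "even (x + y)")
    case True
    then have ab: "b = 0" "a = 1 \<or> a = -1" using assms g by auto
    let ?T = "turn (Suc n) (x + q * a) y"
    have t: "turn n (x + level_sign n * y + q * a) (y - level_sign n * x - q * (level_sign n * a)) = ?T"
      using turn_double[of n "x + q * a" y] by (simp add: algebra_simps)
    have "odd (x + q * a + y)" using True ab assms by auto
    then have "child n (nx q (Suc n) g)
      = ((x + q * a + level_sign n * y, y - level_sign n * (x + q * a)), (level_sign n * (?T * a), 0))"
      by (simp add: g ab)
    moreover have "nx q n (nx q n (child n g))
        = ((x + level_sign n * y + q * a, y - level_sign n * x - q * (level_sign n * a)),
          (?T * (level_sign n * a), 0))"
      unfolding g ab nx_child_even[OF assms(1) True ab(2)] using t by simp
    ultimately show ?thesis by (simp add: algebra_simps)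
  next
    case False
    then have ab: "a = 0" "b = 1 \<or> b = -1" using assms g by auto
    let ?T = "turn (Suc n) x (y + q * b)"
    have t: "turn n (x + level_sign n * y + q * (level_sign n * b)) (y - level_sign n * x + q * b) = ?T"
      using turn_double[of n x "y + q * b"] by (simp add: algebra_simps)
    have "even (x + (y + q * b))" using False ab assms by auto
    then have "child n (nx q (Suc n) g)
      = ((x + level_sign n * (y + q * b), y + q * b - level_sign n * x), (- ?T * b, 0))"
      by (simp add: g ab)
    moreover have "nx q n (nx q n (child n g))
        = ((x + level_sign n * y + q * (level_sign n * b), y - level_sign n * x + q * b), (- ?T * b,
          0))"
      unfolding g ab nx_child_odd[OF assms(1) False ab(2)] using t by simp
    ultimately show ?thesis by (simp add: algebra_simps)
  qed
qed

lemma child_nxt_pow: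
  assumes "odd q" "is_edge g"
  shows "child n ((nx q (Suc n) ^^ k) g) = (nx q n ^^ (2 * k)) (child n g)"
proof (induction k)
  case (Suc k)
  interpret turning q "turn (Suc n)" using assms(1) by (rule turning_turn)
  show ?case using child_nxt[OF assms(1) is_edge_pow[OF assms(2), of k], of n] Suc by simp
qed auto

lemma parent_even_child:
  assumes "is_edge g" shows "parent_even n (child n g) = g"
proof -
  obtain x y a b where g: "g = ((x, y), (a, b))" by (rule edge_cases)
  have "(x + level_sign n * y - level_sign n * (y - level_sign n * x)) div 2 = x"
       "(y - level_sign n * x + level_sign n * (x + level_sign n * y)) div 2 = y"
    using level_sign_cases[of n] by auto
  then show ?thesis using assms level_sign_cases[of n] unfolding g
    by (auto simp: Let_def split: if_splits)
qed

lemma at_even_child: "at_even (child n g)"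
  by (cases g rule: edge_cases) auto

lemma parent_child:
  assumes "is_edge g" shows "parent q n (child n g) = g"
proof -
  obtain x y a b where g: "child n g = ((x, y), (a, b))" by (rule edge_cases)
  then show ?thesis using at_even_child[of n g] parent_even_child[OF assms, of n] by simp
qed

lemma parent_odd:
  assumes "odd q" "odd (x + y)"
  shows "parent q n ((x, y), (a, b)) = parent_even n (prv q (turn n) ((x, y), (a, b)))"
  using assms by (simp add: turn_odd)

lemma parent_nx_child:
  assumes "odd q" "is_edge g" shows "parent q n (nx q n (child n g)) = g"
proof -
  interpret turning q "turn n" using assms(1) by (rule turning_turn)
  obtain x y a b where g: "nx q n (child n g) = ((x, y), (a, b))" by (rule edge_cases)
  then have "odd (x + y)"
    using at_even_nxt[OF is_edge_child, of g n] at_even_child[of n g] assms by simp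
  then have "parent q n (nx q n (child n g)) = parent_even n (prv q (turn n) (nx q n (child n g)))"
    unfolding g by (rule parent_odd[OF assms(1)])
  then show ?thesis by (simp only: prv_nxt parent_even_child[OF assms(2)])
qed

lemma parent_even_cases:
  assumes "is_edge ((x, y), (a, b))" "even (x + y)"
  shows "\<exists>g. is_edge g \<and> ((x, y), (a, b)) = child n g"
proof -
  define u v where "u = (x - level_sign n * y) div 2" and "v = (y + level_sign n * x) div 2"
  have "even (x - level_sign n * y)" "even (y + level_sign n * x)"
    using assms level_sign_cases[of n] by auto
  then have "2 * u = x - level_sign n * y" "2 * v = y + level_sign n * x"
    by (simp_all add: u_def v_def)
  then have xy: "x = u + level_sign n * v" "y = v - level_sign n * u"
    using level_sign_cases[of n] by auto
  have ab: "b = 0" "a = 1 \<or> a = -1" using assms by auto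
  show ?thesis
    by (rule exI[of _ "((u, v), if even (u + v) then (a, 0) else (0, level_sign n * a))"])
      (use ab xy level_sign_cases[of n] in auto)
qed

text \<open>A horizontal segment leaves an even point and is a first half; one step back from a
  vertical segment leads to such a segment.\<close>

lemma edge_child_cases:
  assumes "odd q" "is_edge f"
  obtains g where "is_edge g" "parent q n f = g" "f = child n g \<or> f = nx q n (child n g)"
proof -
  interpret turning q "turn n" using assms(1) by (rule turning_turn)
  obtain x y a b where f: "f = ((x, y), (a, b))" by (rule edge_cases)
  show ?thesis
  proof (cases "even (x + y)")
    case True
    obtain g where "is_edge g" "f = child n g"
      using parent_even_cases[of x y a b n] True assms f by blast
    then show ?thesis using that parent_child by blast
  next
    case False
    obtain x' y' a' b' where f': "prv q (turn n) f = ((x', y'), (a', b'))" by (rule edge_cases)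
    have e: "is_edge ((x', y'), (a', b'))" using f' is_edge_prv[OF assms(2)] by simp
    moreover have "nxt q (turn n) ((x', y'), (a', b')) = ((x, y), (a, b))"
      by (metis f f' nxt_prv)
    then have "even (x' + y')"
      using at_even_nxt[OF e] False by simp
    ultimately obtain g where g: "is_edge g" "prv q (turn n) f = child n g"
      using parent_even_cases[of x' y' a' b' n] f' by metis
    then have "f = nx q n (child n g)" by (metis nxt_prv)
    then show ?thesis using that g(1) parent_nx_child[OF assms(1)] by blast
  qed
qed

lemma edge_eq_nx_child:
  assumes "odd q" "is_edge f"
  obtains i where "is_edge (parent q n f)" "i \<le> 1" "f = (nx q n ^^ i) (child n (parent q n f))"
proof -
  obtain g where g: "is_edge g" "parent q n f = g" "f = child n g \<or> f = nx q n (child n g)"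
    using edge_child_cases[OF assms] .
  show ?thesis
    using g that[of 0] that[of 1] by auto
qed

text \<open>If f is i steps after the first half of its parent, then j steps from f correspond to (j
  + i) div 2 steps of the parent. The crude bound \<open>max 1 (j - 1)\<close> does not deteriorate
  when levels are composed, and still forces a strict decrease for j > 1.\<close>

lemma parent_nx_pow:
  assumes "odd q" "is_edge f"
  shows "\<exists>j'. j' \<le> max 1 (j - 1) \<and> parent q n ((nx q n ^^ j) f) = (nx q (Suc n) ^^ j') (parent q n f)"
proof -
  let ?g = "parent q n f"
  obtain i where i: "is_edge ?g" "i \<le> 1" "(nx q n ^^ i) (child n ?g) = f"
    using edge_eq_nx_child[OF assms] by metis
  define m where "m = (j + i) div 2"
  have e: "is_edge ((nx q (Suc n) ^^ m) ?g)"
    using turning.is_edge_pow[OF turning_turn[OF assms(1)] i(1)] .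
  have "(nx q n ^^ j) f = (nx q n ^^ (j + i)) (child n ?g)"
    using i(3) by (metis funpow_add comp_apply)
  also have "j + i = (j + i) mod 2 + 2 * m" by (simp add: m_def)
  also have "(nx q n ^^ ((j + i) mod 2 + 2 * m)) (child n ?g)
      = (nx q n ^^ ((j + i) mod 2)) (child n ((nx q (Suc n) ^^ m) ?g))"
    by (simp add: funpow_add child_nxt_pow[OF assms(1) i(1)])
  also have "parent q n \<dots> = (nx q (Suc n) ^^ m) ?g"
    by (cases "even (j + i)") (use e in \<open>auto simp: parent_child parent_nx_child assms(1) mod_2_eq_odd\<close>)
  finally have "parent q n ((nx q n ^^ j) f) = (nx q (Suc n) ^^ m) ?g" .
  moreover have "2 * m \<le> j + i" unfolding m_def by simp
  then have "m \<le> max 1 (j - 1)" using i(2) by linarith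
  ultimately show ?thesis by blast
qed

text \<open>A cycle has even length, and the parents of its segments form a cycle of half the length.\<close>

lemma no_cycle:
  assumes "odd q" "is_edge f" "0 < k"
  shows "(nx q n ^^ k) f \<noteq> f"
  using assms(2,3)
proof (induction k arbitrary: n f rule: less_induct)
  case (less k)
  interpret turning q "turn n" using assms(1) by (rule turning_turn)
  show ?case
  proof
    assume k: "(nx q n ^^ k) f = f"
    then have "even k" using at_even_pow[OF less.prems(1), of k] by auto
    then obtain m where m: "k = 2 * m" by blast
    let ?g = "parent q n f"
    obtain i where i: "is_edge ?g" "i \<le> 1" "(nx q n ^^ i) (child n ?g) = f"
      using edge_eq_nx_child[OF assms(1) less.prems(1)] by metis
    \<comment> \<open>Steps are injective, so the cycle through f may be started at the first half
      of its parent instead.\<close>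
    have "(nx q n ^^ (i + k)) (child n ?g) = (nx q n ^^ (k + i)) (child n ?g)"
      by (simp only: add.commute)
    then have "(nx q n ^^ i) ((nx q n ^^ k) (child n ?g)) = (nx q n ^^ i) (child n ?g)"
      using k i(3) by (simp only: funpow_add comp_apply)
    then have "(nx q n ^^ k) (child n ?g) = child n ?g"
      by (rule nxt_pow_inj)
    then have "child n ((nx q (Suc n) ^^ m) ?g) = child n ?g"
      by (simp only: m child_nxt_pow[OF assms(1) i(1)])
    then have "(nx q (Suc n) ^^ m) ?g = ?g"
      using parent_child[OF turning.is_edge_pow[OF turning_turn[OF assms(1)] i(1)]] parent_child[OF
        i(1)]
      by metis
    then show False using less.IH[of m ?g "Suc n"] less.prems i(1) m by auto
  qed
qed

section \<open>Four levels at a time\<close>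

definition same_orbit :: "int \<Rightarrow> nat \<Rightarrow> edge \<Rightarrow> edge \<Rightarrow> bool" where
  "same_orbit q n f g \<longleftrightarrow> (\<exists>j. (nx q n ^^ j) f = g \<or> (nx q n ^^ j) g = f)"

lemma same_orbit_sym: "same_orbit q n f g \<Longrightarrow> same_orbit q n g f"
  by (auto simp: same_orbit_def)

lemma same_orbit_pow: "same_orbit q n ((nx q n ^^ i) h) ((nx q n ^^ j) h)"
proof (induction i j rule: linorder_wlog)
  case (le i j)
  then have "(nx q n ^^ (j - i)) ((nx q n ^^ i) h) = (nx q n ^^ j) h"
    by (metis funpow_add comp_apply le_add_diff_inverse2)
  then show ?case unfolding same_orbit_def by blast
qed (simp add: same_orbit_sym)

text \<open>A path of j parents yields a path of 2 j halves. Since f and g are at most one step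
  beyond the first halves of their parents, both lie on one forward path.\<close>

lemma same_orbit_parent:
  assumes "odd q" "is_edge f" "is_edge g" "same_orbit q (Suc n) (parent q n f) (parent q n g)"
  shows "same_orbit q n f g"
proof -
  have *: "same_orbit q n f g" if fe: "is_edge f" and ge: "is_edge g"
    and j: "(nx q (Suc n) ^^ j) (parent q n f) = parent q n g" for f g j
  proof -
    obtain i where i: "is_edge (parent q n f)" "i \<le> 1" "f = (nx q n ^^ i) (child n (parent q n f))"
      using edge_eq_nx_child[OF assms(1) fe] .
    obtain k where k: "is_edge (parent q n g)" "k \<le> 1" "g = (nx q n ^^ k) (child n (parent q n g))"
      using edge_eq_nx_child[OF assms(1) ge] .
    have "g = (nx q n ^^ (k + 2 * j)) (child n (parent q n f))"
      using k(3) by (simp add: funpow_add child_nxt_pow[OF assms(1) i(1), symmetric] j)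
    then show ?thesis using same_orbit_pow[of q n i "child n (parent q n f)" "k + 2 * j"] i(3) by simp
  qed
  from assms(4) obtain j where "(nx q (Suc n) ^^ j) (parent q n f) = parent q n g
      \<or> (nx q (Suc n) ^^ j) (parent q n g) = parent q n f"
    unfolding same_orbit_def by blast
  then show ?thesis
    using *[OF assms(2,3)] *[OF assms(3,2)] same_orbit_sym by blast
qed

definition parent4 :: "int \<Rightarrow> edge \<Rightarrow> edge" where
  "parent4 q f = parent q 3 (parent q 2 (parent q 1 (parent q 0 f)))"

lemma is_edge_parent: "odd q \<Longrightarrow> is_edge f \<Longrightarrow> is_edge (parent q n f)"
  using edge_eq_nx_child[of q f n] by blast

lemma is_edge_parent4: "odd q \<Longrightarrow> is_edge f \<Longrightarrow> is_edge (parent4 q f)"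
  by (simp add: parent4_def is_edge_parent)

lemma turn_4: "turn 4 = turn 0"
  using turn_add4[of 0] by (intro ext) simp

lemma same_orbit_parent4:
  assumes "odd q" "is_edge f" "is_edge g" "same_orbit q 0 (parent4 q f) (parent4 q g)"
  shows "same_orbit q 0 f g"
proof -
  have "same_orbit q (Suc 3) (parent4 q f) (parent4 q g)"
    using assms(4) by (simp add: same_orbit_def turn_4)
  then have "same_orbit q (Suc 2) (parent q 2 (parent q 1 (parent q 0 f))) (parent q 2 (parent q 1
    (parent q 0 g)))"
    unfolding parent4_def numeral_3_eq_3 numeral_2_eq_2 One_nat_def
    by (rule same_orbit_parent[OF assms(1), rotated 2]) (simp_all add: assms is_edge_parent)
  then have "same_orbit q (Suc 1) (parent q 1 (parent q 0 f)) (parent q 1 (parent q 0 g))"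
    unfolding numeral_2_eq_2 One_nat_def
    by (rule same_orbit_parent[OF assms(1), rotated 2]) (simp_all add: assms is_edge_parent)
  then have "same_orbit q (Suc 0) (parent q 0 f) (parent q 0 g)"
    unfolding One_nat_def
    by (rule same_orbit_parent[OF assms(1), rotated 2]) (simp_all add: assms is_edge_parent)
  then show ?thesis
    by (rule same_orbit_parent[OF assms(1), rotated 2]) (simp_all add: assms is_edge_parent)
qed

lemma parent4_nx_pow:
  assumes "odd q" "is_edge f"
  shows "\<exists>j'. j' \<le> max 1 (j - 1) \<and> parent4 q ((nx q 0 ^^ j) f) = (nx q 0 ^^ j') (parent4 q f)"
proof -
  let ?f1 = "parent q 0 f" let ?f2 = "parent q 1 ?f1" let ?f3 = "parent q 2 ?f2"
  obtain j1 where 1: "j1 \<le> max 1 (j - 1)" "parent q 0 ((nx q 0 ^^ j) f) = (nx q (Suc 0) ^^ j1) ?f1"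
    using parent_nx_pow[OF assms] by blast
  obtain j2 where 2: "j2 \<le> max 1 (j1 - 1)" "parent q 1 ((nx q 1 ^^ j1) ?f1) = (nx q (Suc 1) ^^ j2) ?f2"
    using parent_nx_pow[of q ?f1 j1 1] assms is_edge_parent by blast
  obtain j3 where 3: "j3 \<le> max 1 (j2 - 1)" "parent q 2 ((nx q 2 ^^ j2) ?f2) = (nx q (Suc 2) ^^ j3) ?f3"
    using parent_nx_pow[of q ?f2 j2 2] assms is_edge_parent by blast
  obtain j4 where 4: "j4 \<le> max 1 (j3 - 1)" "parent q 3 ((nx q 3 ^^ j3) ?f3)
    = (nx q (Suc 3) ^^ j4) (parent4 q f)"
    using parent_nx_pow[of q ?f3 j3 3] assms is_edge_parent unfolding parent4_def by blast
  have "parent4 q ((nx q 0 ^^ j) f) = (nx q 0 ^^ j4) (parent4 q f)"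
    using 1(2) 2(2) 3(2) 4(2) turn_4 by (simp add: parent4_def eval_nat_numeral)
  moreover have "j4 \<le> max 1 (j - 1)" using 1(1) 2(1) 3(1) 4(1) by linarith
  ultimately show ?thesis by blast
qed

text \<open>Under \<open>parent4\<close> a distance \<open>j > 1\<close> along a curve decreases strictly.\<close>

lemma parent4_fixed_same_orbit:
  assumes "odd q" "is_edge f" "parent4 q f = f" "parent4 q ((nx q 0 ^^ j) f) = (nx q 0 ^^ j) f"
  shows "(nx q 0 ^^ j) f = f \<or> (nx q 0 ^^ j) f = nx q 0 f"
  using assms(4)
proof (induction j rule: less_induct)
  case (less j)
  obtain j' where j': "j' \<le> max 1 (j - 1)" "parent4 q ((nx q 0 ^^ j) f) = (nx q 0 ^^ j') f"
    using parent4_nx_pow[OF assms(1,2), of j] assms(3) by auto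
  then have eq: "(nx q 0 ^^ j) f = (nx q 0 ^^ j') f" using less.prems by simp
  show ?case
  proof (cases "j' \<le> 1")
    case True
    then have "j' = 0 \<or> j' = 1" by auto
    then show ?thesis using eq by auto
  next
    case False
    then have "j' < j" using j'(1) by auto
    then show ?thesis using less eq by simp
  qed
qed

section \<open>Contraction of the plane by four unfoldings\<close>

lemma parent_even_bound:
  assumes "even (x + y)"
  shows "\<exists>x' y' d'. parent_even n ((x, y), d) = ((x', y'), d') \<and>
    2 * x' = x - level_sign n * y \<and> 2 * y' = y + level_sign n * x"
proof -
  have "even (x - level_sign n * y)" "even (y + level_sign n * x)"
    using assms by auto
  then show ?thesis by (cases d) (simp add: Let_def)
qed

text \<open>The pair (c, e) is the step back to the first half: zero for a horizontal segment,
  horizontal of length q for a vertical one.\<close>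

lemma parent_bound:
  assumes "odd q" "q > 0" "is_edge ((x, y), d)"
  shows "\<exists>x' y' d' c e. parent q n ((x, y), d) = ((x', y'), d') \<and> \<bar>c\<bar> + \<bar>e\<bar> \<le> q \<and> q dvd c \<and> q dvd e \<and>
    2 * x' = x + c - level_sign n * (y + e) \<and> 2 * y' = y + e + level_sign n * (x + c)"
proof (cases "even (x + y)")
  case True
  then have "parent q n ((x, y), d) = parent_even n ((x, y), d)" by (cases d) simp
  then show ?thesis using parent_even_bound[OF True, of n d] assms(2)
    by (metis add_0_right abs_0 less_imp_le dvd_0_right)
next
  case False
  then have d: "d = (0, 1) \<or> d = (0, -1)" using assms(3) by (cases d) auto
  define c where "c = - q * (if even x then level_sign n else - level_sign n) * snd d"
  have "\<bar>c\<bar> \<le> q" using d level_sign_cases[of n] assms(2) by (auto simp: c_def)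
  moreover have "q dvd c" by (simp add: c_def)
  moreover have "parent q n ((x, y), d)
    = parent_even n ((x + c, y), (if even x then level_sign n else - level_sign n) * snd d, 0)"
    using d False by (auto simp: c_def simp del: parent_even.simps)
  moreover have "even (x + c + y)"
    using False d assms(1) by (auto simp: c_def)
  ultimately show ?thesis using parent_even_bound[of "x + c" y n]
    by (metis add_0_right abs_0 dvd_0_right)
qed

definition near :: "int \<Rightarrow> edge \<Rightarrow> bool" where
  "near M f \<longleftrightarrow> \<bar>fst (fst f)\<bar> \<le> M \<and> \<bar>snd (fst f)\<bar> \<le> M"

definition small_edges :: "int list \<Rightarrow> int list \<Rightarrow> edge list" where
  "small_edges xs ys = [((x, y), d). x \<leftarrow> xs, y \<leftarrow> ys, d \<leftarrow> [(1, 0), (-1, 0), (0, 1), (0, -1)]]"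

lemma mem_small_edges:
  "is_edge ((x, y), d) \<Longrightarrow> x \<in> set xs \<Longrightarrow> y \<in> set ys \<Longrightarrow> ((x, y), d) \<in> set (small_edges xs ys)"
  by (cases d) (auto simp: small_edges_def split: if_splits)

text \<open>The four values are the segments that leave or enter 0. Two rounds of four levels
  suffice from the box of radius 2.\<close>

lemma parent4_small_1: "\<forall>f\<in>set (small_edges [-2,-1,0,1,2] [-2,-1,0,1,2]). is_edge f \<longrightarrow>
   parent4 1 (parent4 1 f) \<in> {((0, 0), (1, 0)), ((0, 0), (-1, 0)), ((0, 1), (0, -1)), ((0, -1), (0,
     1))}"
  by (simp add: small_edges_def) (simp add: parent4_def level_sign_def Let_def)

text \<open>The lists contain the numbers in [-6, 6] congruent to 1, respectively 0, modulo 3: the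
  box of radius 2 q for q = 3, restricted to one coset.\<close>

lemma parent4_small_3: "\<forall>f\<in>set (small_edges [-5,-2,1,4] [-6,-3,0,3,6]). is_edge f \<longrightarrow>
   parent4 3 (parent4 3 f) \<in> {((1, 3), (-1, 0)), ((-2, -3), (0, 1)), ((1, 0), (0, -1)), ((-2, 0),
     (1, 0))}"
  by (simp add: small_edges_def) (simp add: parent4_def level_sign_def Let_def)

text \<open>Undoing the four divisions gives 4 z4 = z0 + d0 + (1 + i) d1 + 2 i d2 + 2 (1 + i) d3
  with dk = ck + i ek. As |ck| + |ek| <= q, each coordinate of the error is at most q + q + 2 q + 2
  q.\<close>

lemma parent4_displacement:
  assumes "odd q" "q > 0" "is_edge f"
  shows "\<exists>c e. q dvd c \<and> q dvd e \<and> \<bar>c\<bar> \<le> 6 * q \<and> \<bar>e\<bar> \<le> 6 * q \<and>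
    4 * fst (fst (parent4 q f)) = fst (fst f) + c \<and> 4 * snd (fst (parent4 q f)) = snd (fst f) + e"
proof -
  have bound: "\<bar>c + d - 2 * e + 2 * h\<bar> \<le> 6 * q"
    if "\<bar>c\<bar> \<le> q" "\<bar>d\<bar> \<le> q" "\<bar>e\<bar> \<le> q" "\<bar>h\<bar> \<le> q" for c d e h :: int
    using that by linarith
  obtain x0 y0 d0 where f0: "f = ((x0, y0), d0)" by (metis prod.collapse)
  obtain x1 y1 d1 c0 e0 where f1: "parent q 0 f
    = ((x1, y1), d1)" and 1: "\<bar>c0\<bar> + \<bar>e0\<bar> \<le> q" "q dvd c0" "q dvd e0"
    "2 * x1 = x0 + c0 - level_sign 0 * (y0 + e0)" "2 * y1 = y0 + e0 + level_sign 0 * (x0 + c0)"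
    using parent_bound[of q x0 y0 d0 0] assms f0 by auto
  obtain x2 y2 d2 c1 e1 where f2: "parent q 1 (parent q 0 f)
    = ((x2, y2), d2)" and 2: "\<bar>c1\<bar> + \<bar>e1\<bar> \<le> q" "q dvd c1" "q dvd e1"
    "2 * x2 = x1 + c1 - level_sign 1 * (y1 + e1)" "2 * y2 = y1 + e1 + level_sign 1 * (x1 + c1)"
    using parent_bound[of q x1 y1 d1 1] assms is_edge_parent[of q f 0] f1 by auto
  obtain x3 y3 d3 c2 e2 where f3: "parent q 2 (parent q 1 (parent q 0 f))
    = ((x3, y3), d3)" and 3: "\<bar>c2\<bar> + \<bar>e2\<bar> \<le> q" "q dvd c2" "q dvd e2"
    "2 * x3 = x2 + c2 - level_sign 2 * (y2 + e2)" "2 * y3 = y2 + e2 + level_sign 2 * (x2 + c2)"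
    using parent_bound[of q x2 y2 d2 2] assms is_edge_parent[of q
      "parent q 0 f" 1] is_edge_parent[of q f 0] f2 by auto
  obtain x4 y4 d4 c3 e3 where f4: "parent4 q f
    = ((x4, y4), d4)" and 4: "\<bar>c3\<bar> + \<bar>e3\<bar> \<le> q" "q dvd c3" "q dvd e3"
    "2 * x4 = x3 + c3 - level_sign 3 * (y3 + e3)" "2 * y4 = y3 + e3 + level_sign 3 * (x3 + c3)"
    using parent_bound[of q x3 y3 d3 3] assms is_edge_parent[of q "parent q 1 (parent q 0 f)" 2]
      is_edge_parent[of q "parent q 0 f" 1] is_edge_parent[of q f 0] f3 unfolding parent4_def by auto
  have s: "level_sign 0 = -1" "level_sign 1 = -1" "level_sign 2 = 1" "level_sign 3 = 1"
    by (simp_all add: level_sign_def)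
  have "4 * x4 = x0 + (c0 + (c1 - e1) - 2 * e2 + 2 * (c3 - e3))"
    "4 * y4 = y0 + (e0 + (c1 + e1) - 2 * (- c2) + 2 * (c3 + e3))"
    using 1(4,5) 2(4,5) 3(4,5) 4(4,5) unfolding s by (simp_all add: algebra_simps)
  moreover have "\<bar>c0\<bar> \<le> q" "\<bar>e0\<bar> \<le> q"
    using 1(1) by linarith+
  moreover have "\<bar>c1 - e1\<bar> \<le> q" "\<bar>c1 + e1\<bar> \<le> q"
    using 2(1) by linarith+
  moreover have "\<bar>e2\<bar> \<le> q" "\<bar>c2\<bar> \<le> q"
    using 3(1) by linarith+
  moreover have "\<bar>c3 - e3\<bar> \<le> q" "\<bar>c3 + e3\<bar> \<le> q"
    using 4(1) by linarith+
  moreover have "q dvd c0 + (c1 - e1) - 2 * e2 + 2 * (c3 - e3)"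
    "q dvd e0 + (c1 + e1) - 2 * (- c2) + 2 * (c3 + e3)"
    using 1(2,3) 2(2,3) 3(2,3) 4(2,3) by (auto intro!: dvd_add dvd_diff dvd_mult)
  moreover have "\<bar>c0 + (c1 - e1) - 2 * e2 + 2 * (c3 - e3)\<bar> \<le> 6 * q"
    by (rule bound) fact+
  moreover have "\<bar>- c2\<bar> \<le> q" using \<open>\<bar>c2\<bar> \<le> q\<close> by simp
  then have "\<bar>e0 + (c1 + e1) - 2 * (- c2) + 2 * (c3 + e3)\<bar> \<le> 6 * q"
    using bound[of e0 "c1 + e1" "- c2" "c3 + e3"] \<open>\<bar>e0\<bar> \<le> q\<close> \<open>\<bar>c1 + e1\<bar> \<le> q\<close> \<open>\<bar>c3 + e3\<bar> \<le> q\<close> by blast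
  ultimately show ?thesis unfolding f4 unfolding f0 fst_conv snd_conv by blast
qed

lemma near_parent4:
  assumes "odd q" "q > 0" "is_edge f" "near M f"
  shows "near ((M + 6 * q) div 4) (parent4 q f)"
proof -
  obtain c e where "\<bar>c\<bar> \<le> 6 * q" "\<bar>e\<bar> \<le> 6 * q" "4 * fst (fst (parent4 q f)) = fst (fst f) + c"
    "4 * snd (fst (parent4 q f)) = snd (fst f) + e"
    using parent4_displacement[OF assms(1-3)] by blast
  moreover have "\<bar>fst (fst f)\<bar> \<le> M" "\<bar>snd (fst f)\<bar> \<le> M" using assms(4) by (auto simp: near_def)
  ultimately show ?thesis unfolding near_def by linarith
qed

text \<open>The radius 2 q is the fixed point of M -> (M + 6 q) / 4, so every larger bound shrinks
  strictly.\<close>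

lemma parent4_near:
  assumes "odd q" "q > 0" "is_edge f"
  shows "\<exists>k. near (2 * q) ((parent4 q ^^ k) f)"
proof -
  have "\<exists>k. near (2 * q) ((parent4 q ^^ k) f)" if "near M f" "is_edge f" for M f
    using that
  proof (induction "nat M" arbitrary: M f rule: less_induct)
    case less
    show ?case
    proof (cases "M \<le> 2 * q")
      case True
      then have "near (2 * q) ((parent4 q ^^ 0) f)" using less.prems by (auto simp: near_def)
      then show ?thesis by blast
    next
      case False
      then have "nat ((M + 6 * q) div 4) < nat M" using assms by linarith
      then obtain k where "near (2 * q) ((parent4 q ^^ k) (parent4 q f))"
        using less near_parent4[OF assms(1,2)] is_edge_parent4[OF assms(1)] by blast
      then have "near (2 * q) ((parent4 q ^^ Suc k) f)" by (simp add: funpow_swap1)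
      then show ?thesis by blast
    qed
  qed
  moreover have "near (\<bar>fst (fst f)\<bar> + \<bar>snd (fst f)\<bar>) f" by (simp add: near_def)
  ultimately show ?thesis using assms(3) by blast
qed

lemma is_edge_parent4_pow: "odd q \<Longrightarrow> is_edge f \<Longrightarrow> is_edge ((parent4 q ^^ k) f)"
  by (induction k) (auto simp: is_edge_parent4)

section \<open>The four orbits for segments of length 3\<close>

definition roots3 :: "edge set" where
  "roots3 = {((1, 3), (-1, 0)), ((-2, -3), (0, 1)), ((1, 0), (0, -1)), ((-2, 0), (1, 0))}"

text \<open>These are the starting points 3 z + 1 of the images of unit segments under
  \<open>scale3\<close> below.\<close>

definition coset3 :: "edge \<Rightarrow> bool" where
  "coset3 f \<longleftrightarrow> fst (fst f) mod 3 = 1 \<and> snd (fst f) mod 3 = 0"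

text \<open>The displacements are multiples of 3, and 4 is congruent to 1 modulo 3.\<close>

lemma coset3_parent4:
  assumes "is_edge f" "coset3 f"
  shows "coset3 (parent4 3 f)"
proof -
  obtain c e where "3 dvd c" "3 dvd e" "4 * fst (fst (parent4 3 f)) = fst (fst f) + c"
    "4 * snd (fst (parent4 3 f)) = snd (fst f) + e"
    using parent4_displacement[of 3 f] assms(1) by auto
  then show ?thesis using assms(2) unfolding coset3_def by presburger
qed

lemma coset3_parent4_pow: "is_edge f \<Longrightarrow> coset3 f \<Longrightarrow> coset3 ((parent4 3 ^^ k) f)"
  by (induction k) (auto intro!: coset3_parent4 is_edge_parent4_pow)

lemma roots3_props:
  assumes "r \<in> roots3" shows "is_edge r" "parent4 3 r = r" "coset3 r"
  using assms unfolding roots3_def by (auto simp: parent4_def level_sign_def Let_def coset3_def)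

lemma eventually_roots3:
  assumes "is_edge f" "coset3 f"
  shows "\<exists>k. (parent4 3 ^^ k) f \<in> roots3"
proof -
  obtain k where k: "near (2 * 3) ((parent4 3 ^^ k) f)"
    using parent4_near[of 3 f] assms by auto
  obtain x y d where g: "(parent4 3 ^^ k) f = ((x, y), d)" by (metis prod.collapse)
  have "x mod 3 = 1" "y mod 3 = 0" "\<bar>x\<bar> \<le> 6" "\<bar>y\<bar> \<le> 6"
    using k coset3_parent4_pow[OF assms, of k] unfolding g near_def coset3_def by auto
  then have "x \<in> {-5, -2, 1, 4}" "y \<in> {-6, -3, 0, 3, 6}" by simp_all presburger+
  then have "((x, y), d) \<in> set (small_edges [-5,-2,1,4] [-6,-3,0,3,6])"
    using is_edge_parent4_pow[of 3 f k] assms(1) unfolding g by (intro mem_small_edges) auto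
  then have "parent4 3 (parent4 3 ((parent4 3 ^^ k) f)) \<in> roots3"
    using parent4_small_3 is_edge_parent4_pow[of 3 f k] assms(1) unfolding roots3_def g by simp
  then have "(parent4 3 ^^ Suc (Suc k)) f \<in> roots3" by simp
  then show ?thesis by blast
qed

lemma same_orbit_parent4_pow:
  assumes "odd q" "is_edge f" "is_edge g" "same_orbit q 0 ((parent4 q ^^ k) f) ((parent4 q ^^ k) g)"
  shows "same_orbit q 0 f g"
  using assms(4)
proof (induction k)
  case (Suc k)
  then show ?case using same_orbit_parent4[OF assms(1)] is_edge_parent4_pow[OF assms(1)] assms by simp
qed simp

text \<open>Let r be the k-th image of f. Being fixed, r is also its own k-th image, so f and r have
  equal k-th images; pulling back through the levels puts them on one curve.\<close>

lemma same_orbit_roots3: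
  assumes "is_edge f" "coset3 f"
  shows "\<exists>r\<in>roots3. same_orbit 3 0 r f"
proof -
  obtain k where k: "(parent4 3 ^^ k) f \<in> roots3"
    using eventually_roots3[OF assms] by blast
  let ?r = "(parent4 3 ^^ k) f"
  have "(parent4 3 ^^ m) ?r = ?r" for m
    using roots3_props(2)[OF k] by (induction m) auto
  moreover have "same_orbit 3 0 ?r ?r" unfolding same_orbit_def by (rule exI[of _ 0]) simp
  ultimately have "same_orbit 3 0 ?r f"
    using roots3_props(1)[OF k] assms(1) by (intro same_orbit_parent4_pow[of 3 ?r f k]) auto
  then show ?thesis using k by blast
qed

text \<open>The successor of the root ((-2, -3), (0, 1)) starts at -2, as does the root ((-2, 0),
  (1, 0)); this value shows that their directions differ.\<close>

lemma turn_minus_2_0: "turn 0 (- 2) 0 = 1"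
  using turn_double[of 0 "-1" 1] turn_double[of 1 0 1]
    by (simp add: level_sign_def turn_odd numeral_2_eq_2)

lemma roots3_distinct_orbits:
  assumes "r \<in> roots3" "r' \<in> roots3" "same_orbit 3 0 r r'"
  shows "r = r'"
proof -
  have *: "r = r'" if "r \<in> roots3" "r' \<in> roots3" "(nx 3 0 ^^ j) r = r'" for r r' j
  proof -
    have "r' = r \<or> r' = nx 3 0 r"
      using parent4_fixed_same_orbit[of 3 r j] roots3_props[OF that(1)] roots3_props[OF that(2)]
        that(3) by auto
    moreover have "nx 3 0 r \<notin> roots3"
      using that(1) unfolding roots3_def by (auto simp: turn_minus_2_0 turn_odd level_sign_def)
    ultimately show ?thesis using that(2) by auto
  qed
  show ?thesis using assms * unfolding same_orbit_def by metis
qed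

section \<open>The rotated copies of the folding curve cover the plane\<close>

definition base :: edge where "base = ((0, 0), (1, 0))"

fun neg :: "edge \<Rightarrow> edge" where
  "neg ((x, y), (a, b)) = ((- x, - y), (- a, - b))"

text \<open>Reversal followed by the rotation of angle \<open>\<pi>/2\<close> around \<open>0\<close>.\<close>

fun flip :: "edge \<Rightarrow> edge" where
  "flip ((x, y), (a, b)) = ((- (y + b), x + a), (b, - a))"

lemma nx_neg: "nx q n (neg f) = neg (nx q n f)"
proof (cases f rule: edge_cases)
  case (E x y a b)
  then show ?thesis using turn_neg[of n "x + q * a" "y + q * b"] by simp
qed

lemma nx_pow_neg: "(nx q n ^^ j) (neg f) = neg ((nx q n ^^ j) f)"
  by (induction j) (simp_all add: nx_neg)

lemma is_edge_neg: "is_edge f \<Longrightarrow> is_edge (neg f)"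
  by (cases f rule: edge_cases) (auto split: if_splits)

text \<open>Reversal changes the sign of a turn, and so does the rotation by
  \<open>turn_rot\<close>. The two signs cancel, so flipped paths follow the same turns, in the
  opposite order. At 0 \<open>turn_rot\<close> fails, hence the assumption.\<close>

lemma nx_flip:
  assumes "fst (nx 1 n g) \<noteq> (0, 0)"
  shows "nx 1 n (flip (nx 1 n g)) = flip g"
proof (cases g rule: edge_cases)
  case (E x y a b)
  let ?T = "turn n (x + a) (y + b)"
  have "turn n (- (y + b)) (x + a) = - ?T"
    using assms E by (intro turn_rot) auto
  moreover have "?T * ?T = 1" using turn_cases[of n "x + a" "y + b"] by auto
  ultimately show ?thesis using E by (simp add: algebra_simps)
qed

lemma is_edge_base: "is_edge base"
  by (simp add: base_def)

lemma child_base: "child n base = base"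
  by (simp add: base_def)

lemma child_neg_base: "child n (neg base) = neg base"
  by (simp add: base_def)

lemma nx_base_even: "(nx 1 n ^^ (2 * k)) base = child n ((nx 1 (Suc n) ^^ k) base)"
  using child_nxt_pow[of 1 base n k] is_edge_base by (simp add: child_base)

text \<open>After an odd number of steps the coordinate sum is odd. After an even number the point
  is 1 - e i times a point of the next level that is reached in half as many steps.\<close>

lemma base_path_nonzero: "0 < j \<Longrightarrow> fst ((nx 1 n ^^ j) base) \<noteq> (0, 0)"
proof (induction j arbitrary: n rule: less_induct)
  case (less j)
  obtain x y d where f: "(nx 1 n ^^ j) base = ((x, y), d)" by (metis prod.collapse)
  show ?case
  proof (cases "even j")
    case True
    then obtain k where k: "j = 2 * k" by blast
    obtain u v e where g: "(nx 1 (Suc n) ^^ k) base = ((u, v), e)" by (metis prod.collapse)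
    have "(u, v) \<noteq> (0, 0)" using less.IH[of k "Suc n"] less.prems k g by simp
    moreover have "fst ((nx 1 n ^^ j) base) = (u + level_sign n * v, v - level_sign n * u)"
      unfolding k nx_base_even g by (cases e) simp
    ultimately show ?thesis using level_sign_cases[of n] by auto
  next
    case False
    then have "\<not> at_even ((nx 1 n ^^ j) base)"
      using turning.at_even_pow[OF turning_turn[of 1 n] is_edge_base, of j] by (simp add: base_def)
    then show ?thesis unfolding f by auto
  qed
qed

lemma flip_path: "(nx 1 n ^^ j) (flip ((nx 1 n ^^ j) base)) = flip base"
proof (induction j)
  case (Suc j)
  have "nx 1 n (flip ((nx 1 n ^^ Suc j) base)) = flip ((nx 1 n ^^ j) base)"
    using nx_flip[of n "(nx 1 n ^^ j) base"] base_path_nonzero[of "Suc j" n] by simp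
  then show ?case using Suc by (simp add: funpow_swap1 del: nxt.simps)
qed simp

lemma flip_neg: "flip (neg f) = neg (flip f)"
  by (cases f rule: edge_cases) simp

text \<open>The four rays at 0: two leave it through \<open>base\<close> and
  \<open>neg base\<close>, two enter it through \<open>flip base\<close> and
  \<open>flip (neg base)\<close>.\<close>

definition attached :: "nat \<Rightarrow> edge \<Rightarrow> bool" where
  "attached n f \<longleftrightarrow> (\<exists>j. \<exists>r\<in>{base, neg base}. f = (nx 1 n ^^ j) r \<or> (nx 1 n ^^ j) f = flip r)"

lemma attached_parent:
  assumes "is_edge f" "attached (Suc n) (parent 1 n f)"
  shows "attached n f"
proof -
  obtain i where i: "is_edge (parent 1 n f)" "i \<le> 1" "f = (nx 1 n ^^ i) (child n (parent 1 n f))"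
    using edge_eq_nx_child[of 1 f n] assms(1) by auto
  obtain j r where r: "r \<in> {base, neg base}"
    and j: "parent 1 n f = (nx 1 (Suc n) ^^ j) r \<or> (nx 1 (Suc n) ^^ j) (parent 1 n f) = flip r"
    using assms(2) unfolding attached_def by blast
  from j show ?thesis
  proof
    assume "parent 1 n f = (nx 1 (Suc n) ^^ j) r"
    moreover have "child n ((nx 1 (Suc n) ^^ j) r) = (nx 1 n ^^ (2 * j)) r"
      using child_nxt_pow[of 1 r n j] r
        by (auto simp: child_base child_neg_base is_edge_base is_edge_neg)
    ultimately have "f = (nx 1 n ^^ (i + 2 * j)) r"
      using i(3) by (simp add: funpow_add)
    then show ?thesis using r unfolding attached_def by blast
  next
    assume a: "(nx 1 (Suc n) ^^ j) (parent 1 n f) = flip r"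
    \<comment> \<open>A segment that enters 0 is the second half of the segment of the next level
      that enters 0.\<close>
    have "flip r = nx 1 n (child n (flip r))"
      using r level_sign_cases[of n] by (auto simp: base_def turn_odd)
    also have "child n (flip r) = (nx 1 n ^^ (2 * j)) (child n (parent 1 n f))"
      using child_nxt_pow[of 1 "parent 1 n f" n j] i(1) a by simp
    also have "nx 1 n \<dots> = (nx 1 n ^^ Suc (2 * j)) (child n (parent 1 n f))" by simp
    also have "Suc (2 * j) = (Suc (2 * j) - i) + i" using i(2) by simp
    also have "(nx 1 n ^^ \<dots>) (child n (parent 1 n f)) = (nx 1 n ^^ (Suc (2 * j) - i)) f"
      by (simp only: funpow_add comp_apply i(3)[symmetric])
    finally show ?thesis using r unfolding attached_def by metis
  qed
qed

lemma attached_parent4: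
  assumes "is_edge f" "attached 0 (parent4 1 f)"
  shows "attached 0 f"
proof -
  have "attached 4 (parent 1 3 (parent 1 2 (parent 1 1 (parent 1 0 f))))"
    using assms(2) by (simp add: attached_def turn_4 parent4_def)
  then have "attached 3 (parent 1 2 (parent 1 1 (parent 1 0 f)))"
    using attached_parent[of "parent 1 2 (parent 1 1 (parent 1 0 f))" 3] assms
      by (simp add: is_edge_parent)
  then have "attached 2 (parent 1 1 (parent 1 0 f))"
    using attached_parent[of "parent 1 1 (parent 1 0 f)" 2] assms by (simp add: is_edge_parent)
  then have "attached 1 (parent 1 0 f)"
    using attached_parent[of "parent 1 0 f" 1] assms by (simp add: is_edge_parent eval_nat_numeral)
  then show ?thesis
    using attached_parent[of f 0] assms by simp
qed

lemma all_attached: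
  assumes "is_edge f" shows "attached 0 f"
proof -
  have "attached 0 f" if "attached 0 ((parent4 1 ^^ k) f)" for k
    using that
  proof (induction k)
    case (Suc k)
    then show ?case using attached_parent4[OF is_edge_parent4_pow[OF _ assms]] by simp
  qed simp
  moreover obtain k where k: "near (2 * 1) ((parent4 1 ^^ k) f)"
    using parent4_near[of 1 f] assms by auto
  moreover have "attached 0 ((parent4 1 ^^ Suc (Suc k)) f)"
  proof -
    obtain x y d where g: "(parent4 1 ^^ k) f = ((x, y), d)" by (metis prod.collapse)
    have "\<bar>x\<bar> \<le> 2" "\<bar>y\<bar> \<le> 2"
      using k unfolding g near_def by auto
    then have "x \<in> {-2, -1, 0, 1, 2}" "y \<in> {-2, -1, 0, 1, 2}" by auto
    then have "((x, y), d) \<in> set (small_edges [-2,-1,0,1,2] [-2,-1,0,1,2])"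
      using is_edge_parent4_pow[of 1 f k] assms unfolding g by (intro mem_small_edges) auto
    then have "parent4 1 (parent4 1 ((x, y), d)) \<in> {((0, 0), (1, 0)), ((0, 0), (-1, 0)), ((0, 1),
      (0, -1)), ((0, -1), (0, 1))}"
      using parent4_small_1 is_edge_parent4_pow[of 1 f k] assms unfolding g by simp
    \<comment> \<open>The four segments at 0 are the first or last segments of the rays, so j = 0
      works.\<close>
    also have "\<dots> = {base, neg base, flip base, flip (neg base)}"
      by (simp add: base_def)
    finally show ?thesis unfolding attached_def by (intro exI[of _ 0]) (auto simp: g)
  qed
  ultimately show ?thesis by blast
qed

lemma edge_cases_path:
  assumes "is_edge f"
  obtains j where "f \<in> {(nx 1 0 ^^ j) base, neg ((nx 1 0 ^^ j) base),
    flip ((nx 1 0 ^^ j) base), flip (neg ((nx 1 0 ^^ j) base))}"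
proof -
  interpret turning 1 "turn 0" by (rule turning_turn) simp
  obtain j r where r: "r \<in> {base, neg base}" and j: "f = (nx 1 0 ^^ j) r \<or> (nx 1 0 ^^ j) f = flip r"
    using all_attached[OF assms] unfolding attached_def by blast
  have "(nx 1 0 ^^ j) (flip ((nx 1 0 ^^ j) r)) = flip r"
    using r flip_path[of j 0] by (auto simp: nx_pow_neg flip_neg)
  then have "f = (nx 1 0 ^^ j) r \<or> f = flip ((nx 1 0 ^^ j) r)"
    using j nxt_pow_inj by metis
  then show ?thesis using r that[of j] by (auto simp: nx_pow_neg)
qed

section \<open>Turns along the path from the origin\<close>

definition path_turn :: "nat \<Rightarrow> nat \<Rightarrow> int" where
  "path_turn n j = (case fst ((nx 1 n ^^ j) base) of (x, y) \<Rightarrow> turn n x y)"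

lemma path_turn_even: "path_turn n (2 * k) = path_turn (Suc n) k"
proof -
  obtain u v a b where g: "(nx 1 (Suc n) ^^ k) base = ((u, v), (a, b))" by (rule edge_cases)
  show ?thesis unfolding path_turn_def nx_base_even g by (simp add: turn_double)
qed

text \<open>Vertices of odd index are midpoints of segments of the next level, which start
  alternately at even and odd points; hence the alternating creases.\<close>

lemma path_turn_odd: "path_turn n (Suc (2 * k)) = (if even k then - level_sign n else level_sign n)"
proof -
  obtain x y a b where g: "(nx 1 (Suc n) ^^ k) base = ((x, y), (a, b))" by (rule edge_cases)
  have e: "is_edge ((x, y), (a, b))"
    using turning.is_edge_pow[OF turning_turn[of 1 "Suc n"] is_edge_base, of k] unfolding g by simp
  have p: "even (x + y) \<longleftrightarrow> even k"
    using turning.at_even_pow[OF turning_turn[of 1 "Suc n"] is_edge_base, of k] unfolding g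
    by (simp add: base_def)
  have s: "(nx 1 n ^^ Suc (2 * k)) base = nx 1 n (child n ((x, y), (a, b)))"
    using nx_base_even[of k n] g by simp
  show ?thesis
  proof (cases "even k")
    case True
    then have "b = 0" "a = 1 \<or> a = -1" using e p by auto
    then show ?thesis unfolding path_turn_def s using nx_child_even[of 1 x y a n] True p
      by (auto simp: turn_odd)
  next
    case False
    then have "a = 0" "b = 1 \<or> b = -1" using e p by auto
    then show ?thesis unfolding path_turn_def s using nx_child_odd[of 1 x y b n] False p
      by (auto simp: turn_odd)
  qed
qed

lemma path_turn_pow2: "path_turn n (2 ^ N) = - level_sign (n + N)"
proof (induction N arbitrary: n)
  case 0
  show ?case using path_turn_odd[of n 0] by simp
next
  case (Suc N)
  show ?case using path_turn_even[of n "2 ^ N"] Suc[of "Suc n"] by simp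
qed

text \<open>This is the folding rule read around the centre 2^N. For even j both indices descend one
  level. For odd j both are odd, and their halves have different parities, so the alternation of the
  creases applies.\<close>

lemma path_turn_antisym: "0 < j \<Longrightarrow> j < 2 ^ N \<Longrightarrow> path_turn n (2 ^ N + j) = - path_turn n (2 ^ N - j)"
proof (induction N arbitrary: n j)
  case (Suc N)
  show ?case
  proof (cases "even j")
    case True
    then obtain k where k: "j = 2 * k" by blast
    have "2 ^ Suc N + j = 2 * (2 ^ N + k)" "2 ^ Suc N - j = 2 * (2 ^ N - k)" by (simp_all add: k)
    then have "path_turn n (2 ^ Suc N + j) = path_turn (Suc n) (2 ^ N + k)"
      "path_turn n (2 ^ Suc N - j) = path_turn (Suc n) (2 ^ N - k)"
      by (simp_all only: path_turn_even)
    then show ?thesis using Suc.IH[of k "Suc n"] Suc.prems k by simp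
  next
    case False
    then obtain k where k: "j = Suc (2 * k)" by (auto elim!: oddE)
    have eq: "2 ^ Suc N + j = Suc (2 * (2 ^ N + k))" "2 ^ Suc N - j = Suc (2 * (2 ^ N - Suc k))"
      using k Suc.prems by auto
    have "k < 2 ^ N" using k Suc.prems by simp
    then have "(2 ^ N + k) + (2 ^ N - Suc k) = 2 * (2 ^ N - 1) + 1" by auto
    then have odd_sum: "odd ((2 ^ N + k) + (2 ^ N - Suc k))" by simp
    have "even (2 ^ N + k) \<longleftrightarrow> odd (2 ^ N - Suc k)"
      using odd_sum by presburger
    then show ?thesis unfolding eq path_turn_odd by auto
  qed
qed simp

section \<open>Embedding of finite patterns\<close>

definition emb :: "int \<times> int \<Rightarrow> complex" where
  "emb v = Complex (of_int (fst v)) (of_int (snd v))"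

text \<open>The coordinates of edges have origin \<open>x\<close> and unit factor
  \<open>\<epsilon>\<close> in the plane; with \<open>\<epsilon>\<close> equal to i, horizontal
  edges become vertical segments.\<close>

definition place :: "complex \<Rightarrow> complex \<Rightarrow> edge \<Rightarrow> seg" where
  "place x \<epsilon> f = (x + \<epsilon> * emb (fst f), \<epsilon> * emb (snd f))"

lemma emb_eq_iff [simp]: "emb v = emb w \<longleftrightarrow> v = w"
  by (auto simp: emb_def prod_eq_iff)

lemma emb_add: "emb (a + c, b + d) = emb (a, b) + emb (c, d)"
  by (simp add: emb_def complex_eq_iff)

lemma place_inj: "\<epsilon> \<noteq> 0 \<Longrightarrow> place x \<epsilon> f = place x \<epsilon> g \<longleftrightarrow> f = g"
  by (auto simp: place_def prod_eq_iff)

fun translate_edge :: "int \<times> int \<Rightarrow> edge \<Rightarrow> edge" where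
  "translate_edge (m, n) ((x, y), d) = ((x + m, y + n), d)"

lemma translate_edge_inj: "translate_edge v f = translate_edge v g \<longleftrightarrow> f = g"
  by (cases v; cases f rule: edge_cases; cases g rule: edge_cases) auto

lemma translate_place:
  "translate_seg (x' - x + \<epsilon> * emb v) (place x \<epsilon> f) = place x' \<epsilon> (translate_edge v f)"
  by (cases v; cases f rule: edge_cases) (simp add: translate_seg_def place_def emb_add algebra_simps)

text \<open>The curves of \<open>\<C>\<close> run through the placed edges of \<open>A\<close>, with turns prescribed by \<open>t\<close>.\<close>

definition described ::
    "ccurve set \<Rightarrow> complex \<Rightarrow> complex \<Rightarrow> edge set \<Rightarrow> (int \<Rightarrow> int \<Rightarrow> int) \<Rightarrow> bool" where
  "described \<C> x \<epsilon> A t \<longleftrightarrow>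
     segs_of \<C> = place x \<epsilon> ` A \<and> (\<forall>f\<in>A. nxt 1 t f \<in> A) \<and>
     (\<forall>K\<in>\<C>. \<forall>c\<in>K. \<forall>k. \<forall>f\<in>A. c k = place x \<epsilon> f \<longrightarrow> c (k + 1) = place x \<epsilon> (nxt 1 t f))"

abbreviation walk :: "complex \<Rightarrow> complex \<Rightarrow> (int \<Rightarrow> int \<Rightarrow> int) \<Rightarrow> edge \<Rightarrow> nat \<Rightarrow> seg list" where
  "walk x \<epsilon> t f m \<equiv> map (\<lambda>j. place x \<epsilon> ((nxt 1 t ^^ j) f)) [0..<m]"

lemma described_pow:
  assumes "described \<C> x \<epsilon> A t" "K \<in> \<C>" "c \<in> K" "f \<in> A" "c k = place x \<epsilon> f"
  shows "(nxt 1 t ^^ j) f \<in> A \<and> c (k + int j) = place x \<epsilon> ((nxt 1 t ^^ j) f)"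
proof (induction j)
  case 0
  then show ?case using assms by simp
next
  case (Suc j)
  have "c (k + int j + 1) = place x \<epsilon> (nxt 1 t ((nxt 1 t ^^ j) f))"
    using assms Suc unfolding described_def by blast
  moreover have "nxt 1 t ((nxt 1 t ^^ j) f) \<in> A"
    using assms Suc unfolding described_def by blast
  ultimately show ?case by (simp add: algebra_simps)
qed

text \<open>Replaces finite subcurves by walks, so that bounded sets can be compared through edges
  and turns alone.\<close>

lemma described_subcurve_iff:
  assumes "described \<C> x \<epsilon> A t"
  shows "(\<exists>K\<in>\<C>. finite_subcurve b K) \<longleftrightarrow> (\<exists>f\<in>A. \<exists>m>0. b = walk x \<epsilon> t f m)"
proof
  assume "\<exists>K\<in>\<C>. finite_subcurve b K"
  then obtain K c m n where K: "K \<in> \<C>" "c \<in> K" and b: "b \<noteq> []" "b = map c [m..n]"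
    unfolding finite_subcurve_def by blast
  have "c m \<in> segs_of \<C>" using K unfolding segs_of_def by blast
  then obtain f where f: "f \<in> A" "c m = place x \<epsilon> f" using assms unfolding described_def by blast
  have "b = walk x \<epsilon> t f (length b)"
    using described_pow[OF assms K f] by (intro nth_equalityI) (auto simp: b(2))
  then show "\<exists>f\<in>A. \<exists>m>0. b = walk x \<epsilon> t f m" using f(1) b(1) by blast
next
  assume "\<exists>f\<in>A. \<exists>m>0. b = walk x \<epsilon> t f m"
  then obtain f m where f: "f \<in> A" and m: "0 < m" "b = walk x \<epsilon> t f m" by blast
  then have "place x \<epsilon> f \<in> segs_of \<C>" using assms unfolding described_def by blast
  then obtain K c k where K: "K \<in> \<C>" "c \<in> K" "c k = place x \<epsilon> f"
    unfolding segs_of_def by force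
  have "b = map c [k..k + int m - 1]"
    using described_pow[OF assms K(1,2) f K(3)] by (intro nth_equalityI) (auto simp: m(2))
  then show "\<exists>K\<in>\<C>. finite_subcurve b K" using K m unfolding finite_subcurve_def by fastforce
qed

lemma walk_shift:
  assumes "\<And>f. f \<in> W \<Longrightarrow> nxt 1 t' (translate_edge v f) = translate_edge v (nxt 1 t f)"
    and "\<And>i. i < j \<Longrightarrow> (nxt 1 t ^^ i) f \<in> W"
  shows "(nxt 1 t' ^^ j) (translate_edge v f) = translate_edge v ((nxt 1 t ^^ j) f)"
  using assms(2)
proof (induction j)
  case (Suc j)
  then have "(nxt 1 t' ^^ j) (translate_edge v f) = translate_edge v ((nxt 1 t ^^ j) f)" by simp
  then show ?case using assms(1)[OF Suc.prems[of j]] by simp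
qed simp

text \<open>A bounded set involves finitely many edges. A translation compatible with these edges
  and the steps from them carries walks to walks; conversely, a walk of the target inside the image
  pulls back, so the clause on consecutive segments in \<open>bounded_below\<close> is transported
  too.\<close>

lemma embed_bounded:
  assumes C: "described \<C> x \<epsilon> A t" and D: "described \<D> x' \<epsilon> A' t'" and "\<epsilon> \<noteq> 0"
    and match: "\<And>W. finite W \<Longrightarrow> W \<subseteq> A \<Longrightarrow>
      \<exists>v. \<forall>f\<in>W. translate_edge v f \<in> A' \<and> nxt 1 t' (translate_edge v f) = translate_edge v (nxt 1 t f)"
    and B: "bounded_below \<B> \<C>"
  shows "\<exists>\<B>'. bounded_below \<B>' \<D> \<and> translate_of \<B> \<B>'"
proof -
  define W where "W = {f \<in> A. place x \<epsilon> f \<in> (\<Union>b\<in>\<B>. set b)}"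
  have "finite (place x \<epsilon> ` W)"
    by (rule finite_subset[of _ "\<Union>b\<in>\<B>. set b"]) (use B in \<open>auto simp: W_def bounded_below_def\<close>)
  then have "finite W"
    by (rule finite_imageD) (use \<open>\<epsilon> \<noteq> 0\<close> in \<open>auto simp: inj_on_def place_inj\<close>)
  then obtain v where v: "\<And>f. f \<in> W \<Longrightarrow> translate_edge v f \<in> A'"
    "\<And>f. f \<in> W \<Longrightarrow> nxt 1 t' (translate_edge v f) = translate_edge v (nxt 1 t f)"
    using match[of W] unfolding W_def by blast
  define T where "T = translate_seg (x' - x + \<epsilon> * emb v)"
  have T: "T (place x \<epsilon> f) = place x' \<epsilon> (translate_edge v f)" for f
    by (simp add: T_def translate_place)
  have walkB: "\<exists>f m. b = walk x \<epsilon> t f m \<and> f \<in> A \<and> 0 < m \<and> (\<forall>j<m. (nxt 1 t ^^ j) f \<in> W)" if "b \<in> \<B>" for b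
  proof -
    have "\<exists>K\<in>\<C>. finite_subcurve b K"
      using B that unfolding bounded_below_def by blast
    then obtain f m where f: "f \<in> A" "0 < m" "b = walk x \<epsilon> t f m"
      using described_subcurve_iff[OF C, of b] by blast
    have closed: "nxt 1 t g \<in> A" if "g \<in> A" for g
      using C that unfolding described_def by blast
    have "(nxt 1 t ^^ j) f \<in> A" for j
      using f(1) by (induction j) (auto simp: closed simp del: nxt.simps)
    moreover have "place x \<epsilon> ((nxt 1 t ^^ j) f) \<in> set b" if "j < m" for j
      using that by (simp add: f(3))
    ultimately show ?thesis using f that unfolding W_def by blast
  qed
  have mapT: "map T (walk x \<epsilon> t f m) = walk x' \<epsilon> t' (translate_edge v f) m"
    if "\<forall>j<m. (nxt 1 t ^^ j) f \<in> W" for f m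
    using that walk_shift[of W t' v t _ f, OF v(2)] by (auto simp: T)
  have "bounded_below (map T ` \<B>) \<D>"
    unfolding bounded_below_def
  proof (intro conjI ballI allI impI)
    show "finite (map T ` \<B>)" using B by (simp add: bounded_below_def)
  next
    fix b' assume "b' \<in> map T ` \<B>"
    then obtain b where b: "b \<in> \<B>" "b' = map T b" by blast
    obtain f m where f: "b = walk x \<epsilon> t f m" "0 < m" "\<forall>j<m. (nxt 1 t ^^ j) f \<in> W"
      using walkB[OF b(1)] by blast
    have "f \<in> W" using f(2,3) by force
    then have "translate_edge v f \<in> A'" by (rule v(1))
    then show "\<exists>K\<in>\<D>. finite_subcurve b' K"
      using described_subcurve_iff[OF D, of b'] mapT[OF f(3)] f(1,2) b(2) by metis
  next
    fix K s' assume "K \<in> \<D>" and s': "finite_subcurve s' K \<and> set s' \<subseteq> (\<Union>b\<in>map T ` \<B>. set b)"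
    then obtain f' m where f': "f' \<in> A'" "0 < m" "s' = walk x' \<epsilon> t' f' m"
      using described_subcurve_iff[OF D, of s'] \<open>K \<in> \<D>\<close> by blast
    have pre: "\<exists>g\<in>W. (nxt 1 t' ^^ j) f' = translate_edge v g" if "j < m" for j
    proof -
      have "place x' \<epsilon> ((nxt 1 t' ^^ j) f') \<in> set s'" using that f'(3) by simp
      then obtain b s where s: "b \<in> \<B>" "s \<in> set b" "place x' \<epsilon> ((nxt 1 t' ^^ j) f') = T s"
        using s' by fastforce
      obtain f n where fn: "b = walk x \<epsilon> t f n" "\<forall>j<n. (nxt 1 t ^^ j) f \<in> W"
        using walkB[OF s(1)] by blast
      obtain i where i: "i < n" "s = place x \<epsilon> ((nxt 1 t ^^ i) f)"
        using s(2) fn(1) by auto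
      have "(nxt 1 t' ^^ j) f' = translate_edge v ((nxt 1 t ^^ i) f)"
        using s(3) place_inj[OF \<open>\<epsilon> \<noteq> 0\<close>] unfolding i(2) T by blast
      then show ?thesis using fn(2) i(1) by blast
    qed
    obtain f where f: "f \<in> W" "f' = translate_edge v f" using pre[of 0] f'(2) by auto
    \<comment> \<open>The preimage g of the j-th edge must be the j-th successor of f: the earlier
      edges lie in W, where steps commute with the translation.\<close>
    have W: "(nxt 1 t ^^ j) f \<in> W" if "j < m" for j
      using that
    proof (induction j rule: less_induct)
      case (less j)
      obtain g where g: "g \<in> W" "(nxt 1 t' ^^ j) f' = translate_edge v g" using pre less.prems by blast
      have "(nxt 1 t' ^^ j) f' = translate_edge v ((nxt 1 t ^^ j) f)"
        unfolding f(2) by (rule walk_shift[OF v(2)]) (use less in auto)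
      then show ?case using g by (simp add: translate_edge_inj)
    qed
    have "map T (walk x \<epsilon> t f m) = walk x' \<epsilon> t' (translate_edge v f) m"
      by (rule mapT) (use W in blast)
    then have eq: "s' = map T (walk x \<epsilon> t f m)" by (simp only: f'(3) f(2))
    have "f \<in> A" using f(1) by (simp add: W_def)
    then obtain K' where "K' \<in> \<C>" "finite_subcurve (walk x \<epsilon> t f m) K'"
      using described_subcurve_iff[OF C, of "walk x \<epsilon> t f m"] f'(2) by blast
    moreover have "set (walk x \<epsilon> t f m) \<subseteq> (\<Union>b\<in>\<B>. set b)"
      using W by (auto simp: W_def)
    ultimately have "\<exists>b\<in>\<B>. sublist (walk x \<epsilon> t f m) b"
      using B unfolding bounded_below_def by blast
    then show "\<exists>b\<in>map T ` \<B>. sublist s' b" unfolding eq using map_mono_sublist by blast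
  qed
  then show ?thesis unfolding translate_of_def T_def by blast
qed

section \<open>Description of the generated covering\<close>

lemma supp_eq_iff: "supp s = supp s' \<longleftrightarrow> s = s' \<or> s' = rev_seg s"
  by (cases s; cases s') (auto simp: supp_def rev_seg_def doubleton_eq_iff eq_neg_iff_add_eq_0
    add.commute)

lemma complete_curve_assoc:
  assumes "K \<in> complete_curves" "c \<in> K"
  shows "\<exists>a. curve_assoc UNIV a c"
proof -
  obtain c0 a where 0: "curve_assoc UNIV a c0" "K = shift_rel `` {c0}"
    using assms(1) unfolding complete_curves_def quotient_def by blast
  then obtain m where "\<forall>k. c k = c0 (m + k)" using assms(2) by (auto simp: shift_rel_def add.commute)
  then have "curve_assoc UNIV (\<lambda>k. a (m + k)) c"
    using 0(1) by (simp add: curve_assoc_def add.assoc[symmetric])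
  then show ?thesis by blast
qed

lemma complete_curve_shift:
  assumes "K \<in> complete_curves" "c \<in> K" "d \<in> K"
  shows "\<exists>m. \<forall>k. d k = c (k + m)"
proof -
  obtain c0 where "K = shift_rel `` {c0}"
    using assms(1) unfolding complete_curves_def quotient_def by blast
  then obtain m n where "\<forall>k. c k = c0 (k + m)" "\<forall>k. d k = c0 (k + n)"
    using assms(2,3) by (auto simp: shift_rel_def)
  then have "\<forall>k. d k = c (k + (n - m))" by (simp add: algebra_simps)
  then show ?thesis by blast
qed

lemma unit_interval_supp:
  assumes "is_seg s"
  shows "\<exists>z\<in>gauss_int. \<exists>\<epsilon>\<in>{1, \<i>}. supp s = supp (z, \<epsilon>)"
proof -
  obtain z d where s: "s = (z, d)" by (cases s)
  have z: "z \<in> gauss_int" and d: "d = 1 \<or> d = -1 \<or> d = \<i> \<or> d = -\<i>"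
    using assms by (auto simp: is_seg_def s)
  then have zd: "z + d \<in> gauss_int" by (auto simp: gauss_int_def)
  have "supp s = supp (z + d, - d)"
    by (simp add: supp_def s closed_segment_commute)
  then show ?thesis using z zd d s by (metis add.inverse_inverse insertI1 insert_commute)
qed

text \<open>An interval determines the curve and also the index in each representative. So if two
  representatives share an interval, they continue alike in both directions.\<close>

lemma covering_curve_unique:
  assumes "covering \<C>" "K \<in> \<C>" "c \<in> K" "K' \<in> \<C>" "c' \<in> K'" "supp (c k) = supp (c' k')"
  shows "K' = K \<and> c' (k' + j) = c (k + j)"
proof -
  have CC: "\<C> \<subseteq> complete_curves" using assms(1) by (simp add: covering_def)
  obtain a where "curve_assoc UNIV a c" using complete_curve_assoc assms CC by blast
  then have "is_seg (c k)" by (simp add: curve_assoc_def)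
  then obtain z \<epsilon> where z: "z \<in> gauss_int" "\<epsilon> \<in> {1, \<i>}" "supp (c k) = supp (z, \<epsilon>)"
    using unit_interval_supp by blast
  obtain K0 where K0: "K0 \<in> \<C>" "\<And>c. c \<in> K0 \<Longrightarrow> \<exists>!k. supp (c k) = supp (z, \<epsilon>)"
    "\<And>L c k. L \<in> \<C> \<Longrightarrow> L \<noteq> K0 \<Longrightarrow> c \<in> L \<Longrightarrow> supp (c k) \<noteq> supp (z, \<epsilon>)"
    using assms(1)[unfolded covering_def, THEN conjunct2, THEN conjunct1, THEN bspec, OF z(1),
      THEN bspec, OF z(2)]
    by auto
  have "K = K0" using K0(3)[OF assms(2) _ assms(3)] z(3) by blast
  moreover have "K' = K0" using K0(3)[OF assms(4) _ assms(5)] z(3) assms(6) by metis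
  moreover obtain m where m: "\<And>j. c' j = c (j + m)"
    using complete_curve_shift[of K c c'] assms CC calculation by blast
  moreover have "k = k' + m"
    using K0(2)[of c] z(3) assms(3,6) m calculation(1) by metis
  ultimately show ?thesis by (simp add: algebra_simps)
qed

lemma gauss_int_iff: "z \<in> gauss_int \<longleftrightarrow> (\<exists>x y. z = Complex (of_int x) (of_int y))"
  by (auto simp: gauss_int_def complex_eq_iff elim!: Ints_cases)

lemma covering_segs:
  assumes "covering \<C>"
  shows "\<exists>p. \<forall>s. s \<in> segs_of \<C> \<longleftrightarrow>
    (\<exists>x y :: int. fst s = Complex (of_int x) (of_int y) \<and>
      (if even (x + y) = p then snd s = 1 \<or> snd s = -1 else snd s = \<i> \<or> snd s = - \<i>))"
proof -
  have CC: "\<C> \<subseteq> complete_curves" using assms(1) by (simp add: covering_def)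
  obtain p where p: "\<And>x y :: int. let z = Complex (of_int x) (of_int y) in
        segs_at \<C> z =
          (if even (x + y) = p
           then {(z, 1), (z, -1), (z + \<i>, -\<i>), (z - \<i>, \<i>)}
           else {(z + 1, -1), (z - 1, 1), (z, \<i>), (z, -\<i>)})"
    using assms unfolding covering_def orientation_convention_def by blast
  have gauss: "fst s \<in> gauss_int" if "s \<in> segs_of \<C>" for s
  proof -
    from that obtain c k K where "s = c k" "K \<in> \<C>" "c \<in> K" unfolding segs_of_def by blast
    moreover from this obtain a where "curve_assoc UNIV a c" using complete_curve_assoc CC by blast
    ultimately show ?thesis by (simp add: curve_assoc_def is_seg_def)
  qed
  have *: "s \<in> segs_of \<C> \<longleftrightarrow> (if even (x + y) = p then snd s = 1 \<or> snd s = -1 else snd s = \<i> \<or>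
    snd s = - \<i>)"
    if "fst s = Complex (of_int x) (of_int y)" for s x y
  proof -
    obtain z d where s: "s = (z, d)" by (cases s)
    \<comment> \<open>Membership of s is read off from the convention at its starting point.\<close>
    have "s \<in> segs_of \<C> \<longleftrightarrow> s \<in> segs_at \<C> z" by (simp add: segs_at_def s)
    then show ?thesis using p[of x y] that unfolding Let_def s by (auto simp: s)
  qed
  show ?thesis
    by (rule exI[of _ p]) (use gauss gauss_int_iff * in metis)
qed

lemma powi_turn_emb: "s = 1 \<or> s = -1 \<Longrightarrow> \<i> powi s * emb (a, b) = emb (- s * b, s * a)"
  by (auto simp: emb_def complex_eq_iff)

lemma place_nxt:
  assumes "s = 1 \<or> s = -1" "t (u + a) (v + b) = s"
  shows "place x \<epsilon> (nxt 1 t ((u, v), (a, b))) =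
    (let z = place x \<epsilon> ((u, v), (a, b)) in (fst z + snd z, \<i> powi s * snd z))"
  using assms(2) powi_turn_emb[OF assms(1), of a b]
  by (simp add: place_def Let_def emb_add algebra_simps mult.left_commute[of "\<i> powi s"])

section \<open>The folding sequence as the sequence of turns\<close>

lemma length_folding: "S \<in> folding_seqs N \<Longrightarrow> length S = 2 ^ N - 1"
  by (induction N arbitrary: S) (fastforce simp: bar_def)+

lemma infty_folding_antisym:
  assumes "infty_folding_seq a" "0 < j" "j < 2 ^ N"
  shows "a (int (2 ^ N + j)) = - a (int (2 ^ N - j))"
proof -
  let ?L = "map a [1..2 ^ Suc N - 1]"
  have "?L \<in> folding_seqs (Suc N)" using assms(1) unfolding infty_folding_seq_def by blast
  then obtain S e where S: "?L = bar S @ [e] @ S" "S \<in> folding_seqs N" by auto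
  have len: "length S = 2 ^ N - 1" using length_folding[OF S(2)] .
  have lb: "length (bar S) = 2 ^ N - 1" by (simp add: bar_def len)
  \<comment> \<open>List positions start at 0 and the indices of a at 1: the central entry of
    \<open>?L\<close>, at position 2^N - 1, is the value of a at 2^N.\<close>
  have L: "?L ! i = a (1 + int i)" if "i < 2 ^ Suc N - 1" for i
  proof -
    have "int (i + 1) < int (2 ^ Suc N)"
      using that by (subst of_nat_less_iff) simp
    then have "1 + int i \<le> 2 ^ Suc N - 1" by simp
    then show ?thesis by (subst nth_map) (simp_all add: nth_upto)
  qed
  have "a (int (2 ^ N + j)) = ?L ! (2 ^ N + j - 1)"
    using L[of "2 ^ N + j - 1"] assms by (simp add: of_nat_diff)
  also have "\<dots> = S ! (j - 1)"
  proof -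
    have "1 \<le> (2::nat) ^ N" by simp
    then have "\<not> 2 ^ N + j - 1 < 2 ^ N - 1" "2 ^ N + j - 1 - (2 ^ N - 1) = j"
      using assms(2) by linarith+
    then show ?thesis unfolding S(1) nth_append lb using assms(2) by (simp add: nth_Cons')
  qed
  finally have 1: "a (int (2 ^ N + j)) = S ! (j - 1)" .
  have "a (int (2 ^ N - j)) = ?L ! (2 ^ N - j - 1)"
    using L[of "2 ^ N - j - 1"] assms by (simp add: of_nat_diff)
  also have "\<dots> = bar S ! (2 ^ N - j - 1)"
  proof -
    have "2 ^ N - j - 1 < 2 ^ N - (1::nat)"
      using assms(2,3) by linarith
    then show ?thesis unfolding S(1) nth_append lb by simp
  qed
  also have "\<dots> = - (S ! (j - 1))"
  proof -
    have "2 ^ N - j - 1 < 2 ^ N - (1::nat)" "2 ^ N - 1 - Suc (2 ^ N - j - 1) = j - 1"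
      using assms(2,3) by linarith+
    then show ?thesis by (simp only: bar_def rev_nth length_map len nth_map) (simp add: len)
  qed
  finally show ?thesis using 1 by simp
qed

lemma pow2_decomp: "0 < k \<Longrightarrow> \<exists>N j. k = 2 ^ N + j \<and> j < (2::nat) ^ N"
proof (induction k rule: less_induct)
  case (less k)
  show ?case
  proof (cases "k = 1")
    case True
    then show ?thesis by (intro exI[of _ 0]) auto
  next
    case False
    then obtain N j where "k div 2 = 2 ^ N + j" "j < (2::nat) ^ N"
      using less.IH[of "k div 2"] less.prems by auto
    then have "k = 2 ^ Suc N + (2 * j + k mod 2)" "2 * j + k mod 2 < 2 ^ Suc N"
      by (auto simp: mod_2_eq_odd) presburger+
    then show ?thesis by blast
  qed
qed

text \<open>Both sequences agree at the powers of 2 and change sign under reflection in 2^N, which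
  sends 2^N + j with 0 < j < 2^N to a smaller index.\<close>

lemma infty_folding_path_turn:
  assumes "infty_folding_seq a" "\<And>N. a (2 ^ N) = - level_sign N" "0 < k"
  shows "a (int k) = path_turn 0 k"
  using assms(3)
proof (induction k rule: less_induct)
  case (less k)
  obtain N j where k: "k = 2 ^ N + j" "j < 2 ^ N" using pow2_decomp[OF less.prems] by blast
  show ?case
  proof (cases "j = 0")
    case True
    then show ?thesis using assms(2)[of N] path_turn_pow2[of 0 N] k by simp
  next
    case False
    then have "a (int (2 ^ N - j)) = path_turn 0 (2 ^ N - j)"
      using k by (intro less.IH) auto
    then show ?thesis
      using infty_folding_antisym[OF assms(1), of j N] path_turn_antisym[of j N 0] False k by simp
  qed
qed

lemma folding_curve_path:
  assumes "infty_folding_seq a" "\<And>N. a (2 ^ N) = - level_sign N" "curve_assoc {1..} a D"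
  shows "D (int (Suc j)) = place (fst (D 1)) (snd (D 1)) ((nx 1 0 ^^ j) base)"
proof (induction j)
  case 0
  show ?case by (simp add: place_def base_def emb_def complex_eq_iff prod_eq_iff)
next
  case (Suc j)
  let ?x = "fst (D 1)" let ?e = "snd (D 1)"
  obtain u v d1 d2 where f: "(nx 1 0 ^^ j) base = ((u, v), (d1, d2))" by (rule edge_cases)
  have a: "a (int (Suc j)) = turn 0 (u + d1) (v + d2)"
    using infty_folding_path_turn[OF assms(1,2), of "Suc j"] f by (simp add: path_turn_def)
  have "int (Suc j) \<in> {1..}" "int (Suc j) + 1 \<in> {1..}" by auto
  then have step: "fst (D (int (Suc j))) + snd (D (int (Suc j))) = fst (D (int (Suc j) + 1))"
    "snd (D (int (Suc j) + 1)) = \<i> powi a (int (Suc j)) * snd (D (int (Suc j)))"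
    using assms(3) unfolding curve_assoc_def by blast+
  have "D (int (Suc (Suc j))) = D (int (Suc j) + 1)" by (simp add: algebra_simps)
  also have "\<dots> = (fst (D (int (Suc j))) + snd (D (int (Suc j))),
    \<i> powi turn 0 (u + d1) (v + d2) * snd (D (int (Suc j))))"
    unfolding step(1) a[symmetric] step(2)[symmetric] by simp
  also have "\<dots> = place ?x ?e (nx 1 0 ((u, v), (d1, d2)))"
    unfolding place_nxt[OF turn_cases refl] Suc.IH f Let_def by (rule refl)
  finally show ?case by (simp add: f)
qed

lemma emb_units [simp]: "emb (1, 0) = 1" "emb (-1, 0) = -1" "emb (0, 1) = \<i>" "emb (0, -1)
  = - \<i>" "emb (0, 0) = 0"
  by (simp_all add: emb_def complex_eq_iff)

text \<open>Either the horizontal or the vertical segments leave x; the factor 1 or i is chosen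
  accordingly, and parity settles all other points.\<close>

lemma covering_segs_place:
  assumes "covering \<C>" "x \<in> gauss_int"
  shows "\<exists>\<epsilon>\<in>{1, \<i>}. segs_of \<C> = place x \<epsilon> ` {f. is_edge f}"
proof -
  obtain X Y where x: "x = Complex (of_int X) (of_int Y)" using assms(2) gauss_int_iff by blast
  obtain p where p: "\<And>s. s \<in> segs_of \<C> \<longleftrightarrow>
    (\<exists>x y :: int. fst s = Complex (of_int x) (of_int y) \<and>
      (if even (x + y) = p then snd s = 1 \<or> snd s = -1 else snd s = \<i> \<or> snd s = - \<i>))"
    using covering_segs[OF assms(1)] by blast
  show ?thesis
  proof (cases "even (X + Y) = p")
    case True
    have "s \<in> place x 1 ` {f. is_edge f}" if s: "s \<in> segs_of \<C>" for s
    proof -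
      obtain u v where uv: "fst s = Complex (of_int u) (of_int v)"
        "if even (u + v) = p then snd s = 1 \<or> snd s = -1 else snd s = \<i> \<or> snd s = - \<i>"
        using s p by blast
      let ?v = "(u - X, v - Y)"
      have "even (u + v) = p \<longleftrightarrow> even ((u - X) + (v - Y))" using True by auto
      then consider "even ((u - X) + (v - Y))" "snd s = 1" | "even ((u - X) + (v - Y))" "snd s = -1"
          | "odd ((u - X) + (v - Y))" "snd s = \<i>" | "odd ((u - X) + (v - Y))" "snd s = - \<i>"
        using uv(2) by (auto split: if_splits)
      then obtain d where "is_edge (?v, d)" "emb d = snd s"
      proof cases
        case 1
        then show ?thesis by (intro that[of "(1, 0)"]) auto
      next
        case 2
        then show ?thesis by (intro that[of "(-1, 0)"]) auto
      next
        case 3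
        then show ?thesis by (intro that[of "(0, 1)"]) auto
      next
        case 4
        then show ?thesis by (intro that[of "(0, -1)"]) auto
      qed
      then show ?thesis using uv(1)
        by (intro image_eqI[of _ _ "(?v,
          d)"]) (auto simp: place_def emb_def x complex_eq_iff prod_eq_iff)
    qed
    moreover have "place x 1 f \<in> segs_of \<C>" if "is_edge f" for f
    proof (cases f rule: edge_cases)
      case (E u v a b)
      then show ?thesis using that True unfolding p
        by (intro exI[of _ "X + u"] exI[of _ "Y + v"])
          (auto simp: place_def emb_def x complex_eq_iff split: if_splits)
    qed
    ultimately show ?thesis by blast
  next
    case False
    have "s \<in> place x \<i> ` {f. is_edge f}" if s: "s \<in> segs_of \<C>" for s
    proof -
      obtain u v where uv: "fst s = Complex (of_int u) (of_int v)"
        "if even (u + v) = p then snd s = 1 \<or> snd s = -1 else snd s = \<i> \<or> snd s = - \<i>"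
        using s p by blast
      \<comment> \<open>These are the coordinates of (u + i v - x) / i.\<close>
      let ?v = "(v - Y, X - u)"
      have "even (u + v) = p \<longleftrightarrow> odd ((v - Y) + (X - u))" using False by auto
      then consider "odd ((v - Y) + (X - u))" "snd s = 1" | "odd ((v - Y) + (X - u))" "snd s = -1"
          | "even ((v - Y) + (X - u))" "snd s = \<i>" | "even ((v - Y) + (X - u))" "snd s = - \<i>"
        using uv(2) by (auto split: if_splits)
      then obtain d where "is_edge (?v, d)" "\<i> * emb d = snd s"
      proof cases
        case 1
        then show ?thesis by (intro that[of "(0, -1)"]) auto
      next
        case 2
        then show ?thesis by (intro that[of "(0, 1)"]) auto
      next
        case 3
        then show ?thesis by (intro that[of "(1, 0)"]) auto
      next
        case 4
        then show ?thesis by (intro that[of "(-1, 0)"]) auto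
      qed
      then show ?thesis using uv(1)
        by (intro image_eqI[of _ _ "(?v,
          d)"]) (auto simp: place_def emb_def x complex_eq_iff prod_eq_iff)
    qed
    moreover have "place x \<i> f \<in> segs_of \<C>" if "is_edge f" for f
    proof (cases f rule: edge_cases)
      case (E u v a b)
      then show ?thesis using that False unfolding p
        by (intro exI[of _ "X - v"] exI[of _ "Y + u"])
          (auto simp: place_def emb_def x complex_eq_iff split: if_splits)
    qed
    ultimately show ?thesis by blast
  qed
qed

text \<open>The generating curves do not determine the turn \<open>s\<close> at their common initial point.\<close>

definition central_turn :: "int \<Rightarrow> int \<Rightarrow> int \<Rightarrow> int" where
  "central_turn s x y = (if x = 0 \<and> y = 0 then s else turn 0 x y)"

section \<open>Successors in the generated covering\<close>

lemma place_neg: "place x \<epsilon> (neg f) = place x (- \<epsilon>) f"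
  by (cases f rule: edge_cases) (simp add: place_def emb_def complex_eq_iff)

lemma place_flip: "place x \<epsilon> (flip f) = rev_seg (place x (\<epsilon> * \<i>) f)"
  by (cases f rule: edge_cases) (simp add: place_def rev_seg_def emb_def complex_eq_iff algebra_simps)

lemma edge_to_origin:
  assumes "is_edge f" "fst (nxt 1 t f) = (0, 0)"
  shows "f = flip base \<or> f = neg (flip base)"
proof (cases f rule: edge_cases)
  case (E x y a b)
  then have "x = - a" "y = - b" using assms(2) by auto
  then show ?thesis using assms(1) E by (auto simp: base_def split: if_splits)
qed

lemma generated_rays:
  assumes "generated_by \<C> D" "\<And>j. D (int (Suc j)) = place x e ((nx 1 0 ^^ j) base)"
    "fst (D 1) = x" "e \<in> {1, -1, \<i>, -\<i>}" "\<mu> \<in> {1, -1, \<i>, -\<i>}"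
  shows "\<exists>K\<in>\<C>. \<exists>c\<in>K. (\<forall>j. c (int (Suc j)) = place x \<mu> ((nx 1 0 ^^ j) base)) \<or>
    (\<forall>j. c (- int (Suc j)) = rev_seg (place x \<mu> ((nx 1 0 ^^ j) base)))"
proof -
  \<comment> \<open>The rotations are relative to the first direction e of D; together they produce
    rays in all four directions.\<close>
  have "\<exists>u\<in>{1, \<i>, -1, -\<i>}. u * e = \<mu>"
    using assms(4,5) by auto
  then obtain u where u: "u \<in> {1, \<i>, -1, -\<i>}" "u * e = \<mu>" by blast
  have rot: "rotate_seg x u (D (int (Suc j))) = place x \<mu> ((nx 1 0 ^^ j) base)" for j
    unfolding assms(2) by (simp add: rotate_seg_def place_def u(2)[symmetric] algebra_simps)
  have "\<exists>K\<in>\<C>. infinite_subcurve_up_to_reversal (\<lambda>k. rotate_seg x u (D k)) K"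
    using bspec[OF assms(1)[unfolded generated_by_def assms(3)] u(1)] .
  then obtain K where K: "K \<in> \<C>" "infinite_subcurve_up_to_reversal (\<lambda>k. rotate_seg x u (D k)) K" ..
  from K(2) obtain c where "c \<in> K"
    and c: "(\<forall>k\<ge>1. c k = rotate_seg x u (D k)) \<or> (\<forall>k\<ge>1. c (- k) = rev_seg (rotate_seg x u (D k)))"
    unfolding infinite_subcurve_up_to_reversal_def ..
  from c have "(\<forall>j. c (int (Suc j)) = place x \<mu> ((nx 1 0 ^^ j) base)) \<or>
    (\<forall>j. c (- int (Suc j)) = rev_seg (place x \<mu> ((nx 1 0 ^^ j) base)))"
    unfolding rot[symmetric] by (elim disjE) (simp_all del: of_nat_Suc)
  then show ?thesis using K(1) \<open>c \<in> K\<close> by blast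
qed

text \<open>By \<open>edge_cases_path\<close> the segment lies on one of the four rays, and the ray
  is contained in a curve of the covering. The orientation of the covering decides whether the ray
  or its reverse occurs; uniqueness transfers the next segment to c.\<close>

lemma generated_successor:
  assumes "covering \<C>" "\<epsilon> \<in> {1, \<i>}" and segs: "segs_of \<C> = place x \<epsilon> ` {f. is_edge f}"
    and rays: "\<And>\<mu>. \<mu> \<in> {1, -1, \<i>, -\<i>} \<Longrightarrow>
      \<exists>K\<in>\<C>. \<exists>c\<in>K. (\<forall>j. c (int (Suc j)) = place x \<mu> ((nx 1 0 ^^ j) base)) \<or>
    (\<forall>j. c (- int (Suc j)) = rev_seg (place x \<mu> ((nx 1 0 ^^ j) base)))"
    and f: "is_edge f" "fst (nx 1 0 f) \<noteq> (0, 0)"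
    and K: "K \<in> \<C>" "c \<in> K" "c k = place x \<epsilon> f"
  shows "c (k + 1) = place x \<epsilon> (nx 1 0 f)"
proof -
  have eps: "\<epsilon> \<noteq> 0" using assms(2) by auto
  have unique: "c (k + 1) = c' (k' + 1)" if "K' \<in> \<C>" "c' \<in> K'" "c' k' = place x \<epsilon> f" for K' c' k'
    using covering_curve_unique[OF assms(1) K(1,2) that(1,2), of k k' 1] that(3) K(3) by simp
  have seg: "is_edge g" if "K' \<in> \<C>" "c' \<in> K'" "c' k' = place x \<epsilon> g" for K' c' k' g
  proof -
    have "c' k' \<in> segs_of \<C>" using that(1,2) unfolding segs_of_def by blast
    then have "place x \<epsilon> g \<in> segs_of \<C>" by (simp only: that(3))
    then show ?thesis unfolding segs by (auto simp: place_inj[OF eps])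
  qed
  let ?p = "\<lambda>j. (nx 1 0 ^^ j) base"
  obtain j where "f = ?p j \<or> f = neg (?p j) \<or> f = flip (?p j) \<or> f = flip (neg (?p j))"
    using edge_cases_path[OF f(1)] by blast
  then have "(\<exists>\<mu> g. \<mu> \<in> {\<epsilon>, - \<epsilon>} \<and> g \<in> {id, neg} \<and> f = g (?p j) \<and> (\<forall>f. place x \<epsilon> (g f) = place x \<mu> f)) \<or>
    (\<exists>\<mu> g. \<mu> \<in> {\<epsilon>, - \<epsilon>} \<and> g \<in> {id, neg} \<and> f = flip (g (?p j)) \<and>
      (\<forall>f. place x \<epsilon> (flip (g f)) = rev_seg (place x (\<mu> * \<i>) f)))"
    (is "(\<exists>\<mu> g. ?A \<mu> g) \<or> (\<exists>\<mu> g. ?B \<mu> g)")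
  proof (elim disjE)
    assume "f = ?p j" then have "?A \<epsilon> id" by simp then show ?thesis by blast
  next
    assume "f = neg (?p j)" then have "?A (- \<epsilon>) neg" by (simp add: place_neg) then show ?thesis by blast
  next
    assume "f = flip (?p j)" then have "?B \<epsilon> id" by (simp add: place_flip) then show ?thesis by blast
  next
    assume "f = flip (neg (?p j))" then have "?B (- \<epsilon>) neg"
      by (simp add: place_flip place_neg) then show ?thesis by blast
  qed
  then show ?thesis
  proof (elim disjE exE conjE)
    fix \<mu> g assume \<mu>: "\<mu> \<in> {\<epsilon>, - \<epsilon>}" and g: "g \<in> {id, neg}" and fg: "f = g (?p j)"
      and gp: "\<forall>f. place x \<epsilon> (g f) = place x \<mu> f"
    obtain K' c' where K': "K' \<in> \<C>" "c' \<in> K'"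
      and c': "(\<forall>j. c' (int (Suc j)) = place x \<mu> (?p j)) \<or>
        (\<forall>j. c' (- int (Suc j)) = rev_seg (place x \<mu> (?p j)))"
      using rays[of \<mu>] \<mu> assms(2) by auto
    from c' show ?thesis
    proof
      assume a: "\<forall>j. c' (int (Suc j)) = place x \<mu> (?p j)"
      have "c (k + 1) = c' (int (Suc j) + 1)" by (rule unique[OF K']) (simp only: fg gp a)
      also have "\<dots> = c' (int (Suc (Suc j)))" by (simp add: algebra_simps)
      also have "\<dots> = place x \<epsilon> (g (?p (Suc j)))" by (simp only: gp a)
      also have "g (?p (Suc j)) = nx 1 0 f" using g by (auto simp: fg nx_neg)
      finally show ?thesis .
    next
      \<comment> \<open>The wrong orientation: the last segment would enter 0 horizontally, against
        the parity pattern.\<close>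
      assume a: "\<forall>j. c' (- int (Suc j)) = rev_seg (place x \<mu> (?p j))"
      have "c' (- 1) = rev_seg (place x \<mu> base)" using a[rule_format, of 0] by simp
      also have "\<dots> = place x \<epsilon> (g ((1, 0), (-1, 0)))"
        unfolding gp[rule_format] by (simp add: rev_seg_def place_def base_def)
      finally have "is_edge (g ((1, 0), (-1, 0)))" using seg[OF K'] by blast
      then show ?thesis using g by auto
    qed
  next
    fix \<mu> g assume \<mu>: "\<mu> \<in> {\<epsilon>, - \<epsilon>}" and g: "g \<in> {id, neg}" and fg: "f = flip (g (?p j))"
      and gp: "\<forall>f. place x \<epsilon> (flip (g f)) = rev_seg (place x (\<mu> * \<i>) f)"
    obtain K' c' where K': "K' \<in> \<C>" "c' \<in> K'"
      and c': "(\<forall>j. c' (int (Suc j)) = place x (\<mu> * \<i>) (?p j)) \<or>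
        (\<forall>j. c' (- int (Suc j)) = rev_seg (place x (\<mu> * \<i>) (?p j)))"
      using rays[of "\<mu> * \<i>"] \<mu> assms(2) by auto
    from c' show ?thesis
    proof
      assume a: "\<forall>j. c' (- int (Suc j)) = rev_seg (place x (\<mu> * \<i>) (?p j))"
      \<comment> \<open>For j = 0 the segment enters 0, which is excluded; otherwise the successor
        on a reversed ray has index j - 1 on the ray.\<close>
      have "j \<noteq> 0"
      proof
        assume "j = 0"
        then show False using f(2) fg g by (auto simp: base_def)
      qed
      then obtain i where j: "j = Suc i" by (cases j) auto
      have "c (k + 1) = c' (- int (Suc j) + 1)" by (rule unique[OF K']) (simp only: fg gp a)
      also have "\<dots> = c' (- int (Suc i))" by (simp add: algebra_simps j)
      also have "\<dots> = place x \<epsilon> (flip (g (?p i)))" by (simp only: gp a)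
      also have "flip (g (?p i)) = nx 1 0 f"
      proof -
        have "nx 1 0 (flip (nx 1 0 (?p i))) = flip (?p i)"
          using nx_flip[of 0 "?p i"] base_path_nonzero[of j 0] by (simp add: j)
        then show ?thesis using g fg by (auto simp: j flip_neg nx_neg)
      qed
      finally show ?thesis .
    next
      \<comment> \<open>The wrong orientation again: the first segment would leave 0
        vertically.\<close>
      assume a: "\<forall>j. c' (int (Suc j)) = place x (\<mu> * \<i>) (?p j)"
      have "c' 1 = place x (\<mu> * \<i>) base" using a[rule_format, of 0] by simp
      also have "\<dots> = place x \<epsilon> (if \<mu> = \<epsilon> then ((0, 0), (0, 1)) else ((0, 0), (0, -1)))"
        using \<mu> by (auto simp: place_def base_def)
      finally have "is_edge (if \<mu> = \<epsilon> then ((0, 0), (0, 1)) else ((0, 0), (0, -1)))"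
        by (rule seg[OF K'])
      then show ?thesis by (auto split: if_splits)
    qed
  qed
qed

lemma generated_described:
  assumes "covering \<C>" "\<epsilon> \<in> {1, \<i>}" and segs: "segs_of \<C> = place x \<epsilon> ` {f. is_edge f}"
    and succ: "\<And>K c k f. is_edge f \<Longrightarrow> fst (nx 1 0 f) \<noteq> (0, 0) \<Longrightarrow> K \<in> \<C> \<Longrightarrow> c \<in> K \<Longrightarrow>
      c k = place x \<epsilon> f \<Longrightarrow> c (k + 1) = place x \<epsilon> (nx 1 0 f)"
  shows "\<exists>s. (s = 1 \<or> s = -1) \<and> described \<C> x \<epsilon> {f. is_edge f} (central_turn s)"
proof -
  have eps: "\<epsilon> \<noteq> 0" using assms(2) by auto
  have CC: "\<C> \<subseteq> complete_curves" using assms(1) by (simp add: covering_def)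
  have into: "\<exists>K\<in>\<C>. \<exists>c\<in>K. \<exists>k s. (s = 1 \<or> s = -1) \<and> c k = place x \<epsilon> ((0, y), (0, - y)) \<and>
    c (k + 1) = place x \<epsilon> ((0, 0), (s * y, 0))" if y: "y = 1 \<or> y = -1" for y
  proof -
    have "is_edge ((0, y), (0, - y))" using y by auto
    then have "place x \<epsilon> ((0, y), (0, - y)) \<in> segs_of \<C>" unfolding segs by blast
    then obtain K c k where K: "K \<in> \<C>" "c \<in> K" "c k = place x \<epsilon> ((0, y), (0, - y))"
      unfolding segs_of_def by force
    obtain a where "curve_assoc UNIV a c" using complete_curve_assoc K CC by blast
    then have s: "a k = 1 \<or> a k = -1" and step: "fst (c k) + snd (c k) = fst (c (k + 1))"
      "snd (c (k + 1)) = \<i> powi (a k) * snd (c k)"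
      by (simp_all add: curve_assoc_def)
    have "c (k + 1) = (fst (c k) + snd (c k), \<i> powi (a k) * snd (c k))"
      using step by (simp add: prod_eq_iff)
    also have "\<dots> = place x \<epsilon> (nxt 1 (\<lambda>_ _. a k) ((0, y), (0, - y)))"
      using place_nxt[OF s, of "\<lambda>_ _. a k" 0 0 y "- y" x \<epsilon>] K(3) by (simp add: Let_def)
    finally show ?thesis using K s by auto
  qed
  obtain K1 c1 k1 s where 1: "K1 \<in> \<C>" "c1 \<in> K1" "c1 k1 = place x \<epsilon> ((0, 1), (0, -1))"
    "c1 (k1 + 1) = place x \<epsilon> ((0, 0), (s, 0))" and s: "s = 1 \<or> s = -1"
    using into[of 1] by auto
  obtain K2 c2 k2 s' where 2: "K2 \<in> \<C>" "c2 \<in> K2" "c2 k2 = place x \<epsilon> ((0, -1), (0, 1))"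
    "c2 (k2 + 1) = place x \<epsilon> ((0, 0), (- s', 0))" and s': "s' = 1 \<or> s' = -1"
    using into[of "-1"] by auto
  \<comment> \<open>With different turns the two segments that enter x would have the same
    successor, hence coincide by uniqueness.\<close>
  have "s' = s"
  proof (rule ccontr)
    assume "s' \<noteq> s"
    then have "- s' = s" using s s' by auto
    then have "c2 (k2 + 1 + (- 1)) = c1 (k1 + 1 + (- 1))"
      using covering_curve_unique[OF assms(1) 1(1,2) 2(1,2),
        of "k1 + 1" "k2 + 1" "- 1"] 1(4) 2(4) by simp
    then show False using 1(3) 2(3) by (simp add: place_inj[OF eps])
  qed
  interpret turning 1 "central_turn s"
    by unfold_locales (use s turn_cases in \<open>auto simp: central_turn_def\<close>)
  have "c (k + 1) = place x \<epsilon> (nxt 1 (central_turn s) f)"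
    if K: "K \<in> \<C>" "c \<in> K" and f: "is_edge f" "c k = place x \<epsilon> f" for K c k f
  proof (cases "fst (nx 1 0 f) = (0, 0)")
    case False
    then have "nxt 1 (central_turn s) f = nx 1 0 f"
      by (cases f rule: edge_cases) (auto simp: central_turn_def)
    then show ?thesis using succ[OF f(1) False K f(2)] by simp
  next
    case True
    have eqs: "flip base = ((0, 1), (0, -1))" "neg (flip base) = ((0, -1), (0, 1))"
      by (simp_all add: base_def)
    from edge_to_origin[OF f(1) True] show ?thesis
    proof
      assume fb: "f = flip base"
      then have "c (k + 1) = c1 (k1 + 1)"
        using covering_curve_unique[OF assms(1) 1(1,2) K, of k1 k 1] 1(3) f(2) by (simp add: eqs)
      then show ?thesis using 1(4) fb by (simp add: eqs central_turn_def)
    next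
      assume fb: "f = neg (flip base)"
      then have "c (k + 1) = c2 (k2 + 1)"
        using covering_curve_unique[OF assms(1) 2(1,2) K, of k2 k 1] 2(3) f(2) by (simp add: eqs)
      then show ?thesis using 2(4) fb \<open>s' = s\<close> by (simp add: eqs central_turn_def)
    qed
  qed
  then have "described \<C> x \<epsilon> {f. is_edge f} (central_turn s)"
    by (auto simp only: described_def segs mem_Collect_eq intro: is_edge_nxt)
  then show ?thesis using s by blast
qed

section \<open>The covering by four curves\<close>

definition turn3 :: "int \<Rightarrow> int \<Rightarrow> int" where
  "turn3 x y = turn 0 (3 * x + 1) (3 * y)"

fun scale3 :: "edge \<Rightarrow> edge" where
  "scale3 ((x, y), d) = ((3 * x + 1, 3 * y), d)"

text \<open>As 3 z + 1 and z differ in parity, horizontal edges leave odd points here, the reverse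
  of \<open>is_edge\<close>.\<close>

definition edges3 :: "edge set" where
  "edges3 = {f. is_edge (scale3 f)}"

abbreviation nx3 :: "edge \<Rightarrow> edge" where "nx3 \<equiv> nxt 1 turn3"
abbreviation pv3 :: "edge \<Rightarrow> edge" where "pv3 \<equiv> prv 1 turn3"

interpretation turning3: turning 1 turn3
  by unfold_locales (use turn_cases in \<open>auto simp: turn3_def\<close>)

lemma scale3_inj: "scale3 f = scale3 g \<longleftrightarrow> f = g"
  by (cases f rule: edge_cases; cases g rule: edge_cases) auto

lemma scale3_nx3: "scale3 (nx3 f) = nx 3 0 (scale3 f)"
  by (cases f rule: edge_cases) (simp add: turn3_def algebra_simps)

lemma scale3_pow: "scale3 ((nx3 ^^ j) f) = (nx 3 0 ^^ j) (scale3 f)"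
  by (induction j) (simp_all add: scale3_nx3 del: nxt.simps)

lemma coset3_scale3: "coset3 (scale3 f)"
  by (cases f rule: edge_cases) (simp add: coset3_def)

lemma nx3_in: "f \<in> edges3 \<Longrightarrow> nx3 f \<in> edges3"
  using turning.is_edge_nxt[OF turning_turn[of 3 0]] by (simp add: edges3_def scale3_nx3 del: nxt.simps)

lemma pv3_in:
  assumes "f \<in> edges3" shows "pv3 f \<in> edges3"
proof -
  interpret turning 3 "turn 0" by (rule turning_turn) simp
  have "scale3 f = nx 3 0 (scale3 (pv3 f))"
    by (simp only: scale3_nx3[symmetric] turning3.nxt_prv)
  then have "scale3 (pv3 f) = prv 3 (turn 0) (scale3 f)" by (simp only: prv_nxt)
  then show ?thesis using assms is_edge_prv unfolding edges3_def by simp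
qed

section \<open>Orbits indexed by the integers\<close>

definition orbit :: "edge \<Rightarrow> int \<Rightarrow> edge" where
  "orbit f k = (if k \<ge> 0 then (nx3 ^^ nat k) f else (pv3 ^^ nat (- k)) f)"

lemma orbit_0 [simp]: "orbit f 0 = f"
  by (simp add: orbit_def)

lemma orbit_succ: "orbit f (k + 1) = nx3 (orbit f k)"
proof (cases "k \<ge> 0")
  case True
  then have "nat (k + 1) = Suc (nat k)" by simp
  then show ?thesis using True by (simp add: orbit_def del: nxt.simps)
next
  case False
  then have n: "nat (- k) = Suc (nat (- (k + 1)))" by simp
  have "nx3 ((pv3 ^^ nat (- k)) f) = (pv3 ^^ nat (- (k + 1))) f"
    unfolding n by (simp del: nxt.simps prv.simps)
  moreover have "orbit f (k + 1) = (pv3 ^^ nat (- (k + 1))) f"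
    using False by (cases "k = -1") (auto simp: orbit_def)
  ultimately show ?thesis using False by (simp add: orbit_def del: nxt.simps)
qed

lemma orbit_unique:
  assumes "\<And>k. h (k + 1) = nx3 (h k)"
  shows "h k = orbit (h 0) k"
proof (induction k rule: int_induct[where k = 0])
  case (step1 i)
  then show ?case using assms orbit_succ by simp
next
  case (step2 i)
  have "nx3 (h (i - 1)) = nx3 (orbit (h 0) (i - 1))"
    using assms[of "i - 1"] orbit_succ[of "h 0" "i - 1"] step2 by simp
  then show ?case by (metis turning3.prv_nxt)
qed simp

lemma orbit_orbit: "orbit (orbit f k) j = orbit f (k + j)"
  using orbit_unique[of "\<lambda>j. orbit f (k + j)" j] orbit_succ[of f] by (simp add: add.assoc[symmetric])

lemma orbit_pow: "orbit f (k + int j) = (nx3 ^^ j) (orbit f k)"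
  unfolding orbit_orbit[symmetric] by (simp add: orbit_def)

lemma orbit_in: "f \<in> edges3 \<Longrightarrow> orbit f k \<in> edges3"
proof -
  assume "f \<in> edges3"
  then have "(nx3 ^^ j) f \<in> edges3" "(pv3 ^^ j) f \<in> edges3" for j
    by (induction j) (simp_all add: nx3_in pv3_in del: nxt.simps prv.simps)
  then show ?thesis by (simp add: orbit_def)
qed

lemma orbit_inj:
  assumes "f \<in> edges3" "orbit f k = orbit f l" shows "k = l"
proof -
  have *: False if "k < l" "orbit f k = orbit f l" for k l
  proof -
    have "(nx3 ^^ nat (l - k)) (orbit f k) = orbit f k"
      using orbit_pow[of f k "nat (l - k)"] that by simp
    then have "(nx 3 0 ^^ nat (l - k)) (scale3 (orbit f k)) = scale3 (orbit f k)"
      by (metis scale3_pow)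
    moreover have "is_edge (scale3 (orbit f k))"
      using orbit_in[OF assms(1)] by (simp add: edges3_def)
    ultimately show False using no_cycle[of 3 "scale3 (orbit f k)" "nat (l - k)" 0] that(1) by simp
  qed
  show ?thesis using *[of k l] *[of l k] assms(2) by (metis linorder_neqE)
qed

lemma same_orbit_scale3: "same_orbit 3 0 (scale3 f) (scale3 g) \<longleftrightarrow> (\<exists>k. orbit f k = g)"
proof
  assume "same_orbit 3 0 (scale3 f) (scale3 g)"
  then obtain j where "(nx3 ^^ j) f = g \<or> (nx3 ^^ j) g = f"
    unfolding same_orbit_def scale3_pow[symmetric] scale3_inj by blast
  then have "orbit f (int j) = g \<or> orbit g (int j) = f" by (simp add: orbit_def)
  then show "\<exists>k. orbit f k = g"
    using orbit_orbit[of g "int j" "- int j"] by auto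
next
  assume "\<exists>k. orbit f k = g"
  then obtain k where k: "orbit f k = g" by blast
  show "same_orbit 3 0 (scale3 f) (scale3 g)"
  proof (cases "k \<ge> 0")
    case True
    then have "(nx3 ^^ nat k) f = g" using k by (simp add: orbit_def)
    then show ?thesis unfolding same_orbit_def scale3_pow[symmetric] by blast
  next
    case False
    then have "(nx3 ^^ nat (- k)) g = f"
      using k orbit_pow[of f k "nat (- k)"] by simp
    then show ?thesis unfolding same_orbit_def scale3_pow[symmetric] by blast
  qed
qed

section \<open>The orbits as complete curves, and their number\<close>

definition orbit_curve :: "complex \<Rightarrow> edge \<Rightarrow> int \<Rightarrow> seg" where
  "orbit_curve \<epsilon> f k = place 0 \<epsilon> (orbit f k)"

definition orbit_class :: "complex \<Rightarrow> edge \<Rightarrow> ccurve" where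
  "orbit_class \<epsilon> f = shift_rel `` {orbit_curve \<epsilon> f}"

lemma mem_orbit_class: "c \<in> orbit_class \<epsilon> f \<longleftrightarrow> (\<exists>m. c = (\<lambda>k. orbit_curve \<epsilon> f (k + m)))"
  by (auto simp: orbit_class_def shift_rel_def fun_eq_iff)

lemma orbit_class_eq_iff:
  assumes "\<epsilon> \<noteq> 0"
  shows "orbit_class \<epsilon> f = orbit_class \<epsilon> g \<longleftrightarrow> (\<exists>k. orbit f k = g)"
proof
  assume "orbit_class \<epsilon> f = orbit_class \<epsilon> g"
  moreover have "orbit_curve \<epsilon> g \<in> orbit_class \<epsilon> g" unfolding mem_orbit_class by (rule exI[of _ 0]) simp
  ultimately obtain m where "orbit_curve \<epsilon> g = (\<lambda>k. orbit_curve \<epsilon> f (k + m))"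
    using mem_orbit_class by metis
  then have "orbit_curve \<epsilon> g 0 = orbit_curve \<epsilon> f m" by simp
  then have "orbit f m = g" by (simp add: orbit_curve_def place_inj[OF assms])
  then show "\<exists>k. orbit f k = g" by blast
next
  assume "\<exists>k. orbit f k = g"
  then obtain k where k: "orbit f k = g" by blast
  have "(orbit_curve \<epsilon> f, orbit_curve \<epsilon> g) \<in> shift_rel"
    unfolding shift_rel_def using orbit_orbit[of f k] k
    by (auto simp: orbit_curve_def add.commute intro!: exI[of _ k])
  then show "orbit_class \<epsilon> f = orbit_class \<epsilon> g"
    unfolding orbit_class_def by (rule equiv_class_eq[OF equiv_shift_rel])
qed

definition four_curves :: "complex \<Rightarrow> ccurve set" where
  "four_curves \<epsilon> = orbit_class \<epsilon> ` edges3"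

definition seeds :: "edge set" where
  "seeds = {((0, 1), (-1, 0)), ((-1, -1), (0, 1)), ((0, 0), (0, -1)), ((-1, 0), (1, 0))}"

lemma scale3_seeds: "scale3 ` seeds = roots3"
  by (simp add: seeds_def roots3_def)

text \<open>Under \<open>scale3\<close> the curves become orbits of segments of length 3. Each of
  these contains a root, and different roots lie on different orbits.\<close>

lemma card_four_curves:
  assumes "\<epsilon> \<noteq> 0" shows "card (four_curves \<epsilon>) = 4"
proof -
  have seed: "scale3 r \<in> roots3" if "r \<in> seeds" for r
    using that scale3_seeds by blast
  have "four_curves \<epsilon> = orbit_class \<epsilon> ` seeds"
  proof
    show "orbit_class \<epsilon> ` seeds \<subseteq> four_curves \<epsilon>"
      using roots3_props(1)[OF seed] unfolding four_curves_def edges3_def by blast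
    show "four_curves \<epsilon> \<subseteq> orbit_class \<epsilon> ` seeds"
    proof
      fix K assume "K \<in> four_curves \<epsilon>"
      then obtain f where f: "is_edge (scale3 f)" "K = orbit_class \<epsilon> f"
        unfolding four_curves_def edges3_def by blast
      obtain r where r: "r \<in> roots3" "same_orbit 3 0 r (scale3 f)"
        using same_orbit_roots3[OF f(1) coset3_scale3] by blast
      then obtain s where s: "s \<in> seeds" "r = scale3 s" using scale3_seeds by blast
      then have "orbit_class \<epsilon> s = K"
        using r(2) same_orbit_scale3 orbit_class_eq_iff[OF assms] f(2) by metis
      then show "K \<in> orbit_class \<epsilon> ` seeds" using s(1) by blast
    qed
  qed
  moreover have "inj_on (orbit_class \<epsilon>) seeds"
    by (rule inj_onI)
      (metis orbit_class_eq_iff[OF assms] same_orbit_scale3 roots3_distinct_orbits seed scale3_inj)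
  moreover have "card seeds = 4" by (simp add: seeds_def)
  ultimately show ?thesis by (simp add: card_image)
qed

lemma segs_of_four_curves: "segs_of (four_curves \<epsilon>) = place 0 \<epsilon> ` edges3"
proof
  show "segs_of (four_curves \<epsilon>) \<subseteq> place 0 \<epsilon> ` edges3"
    unfolding segs_of_def four_curves_def
      by (auto simp: mem_orbit_class orbit_curve_def intro!: imageI orbit_in)
  show "place 0 \<epsilon> ` edges3 \<subseteq> segs_of (four_curves \<epsilon>)"
  proof
    fix s assume "s \<in> place 0 \<epsilon> ` edges3"
    then obtain f where f: "f \<in> edges3" "s = place 0 \<epsilon> f" by blast
    have "orbit_curve \<epsilon> f \<in> orbit_class \<epsilon> f" unfolding mem_orbit_class by (rule exI[of _ 0]) simp
    moreover have "s = orbit_curve \<epsilon> f 0" by (simp add: orbit_curve_def f(2))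
    moreover have "orbit_class \<epsilon> f \<in> four_curves \<epsilon>" using f(1) by (simp add: four_curves_def)
    ultimately show "s \<in> segs_of (four_curves \<epsilon>)" unfolding segs_of_def by blast
  qed
qed

lemma described_four_curves:
  assumes "\<epsilon> \<noteq> 0"
  shows "described (four_curves \<epsilon>) 0 \<epsilon> edges3 turn3"
  unfolding described_def
proof (intro conjI ballI allI impI)
  show "segs_of (four_curves \<epsilon>) = place 0 \<epsilon> ` edges3" by (rule segs_of_four_curves)
  show "nx3 f \<in> edges3" if "f \<in> edges3" for f using nx3_in that .
  fix K c k f assume K: "K \<in> four_curves \<epsilon>" "c \<in> K" "c k = place 0 \<epsilon> f"
  then obtain g m where c: "c = (\<lambda>k. orbit_curve \<epsilon> g (k + m))"
    unfolding four_curves_def using mem_orbit_class by blast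
  then have "f = orbit g (k + m)" using K(3) by (simp add: orbit_curve_def place_inj[OF assms])
  then have "nx3 f = orbit g (k + 1 + m)" using orbit_succ[of g "k + m"] by (simp add: algebra_simps)
  then show "c (k + 1) = place 0 \<epsilon> (nx3 f)" by (simp add: c orbit_curve_def)
qed

section \<open>The four orbits form a covering\<close>

lemma rev_seg_rev_seg: "rev_seg (rev_seg s) = s"
  by (cases s) (simp add: rev_seg_def)

lemma place_edges3_iff:
  assumes "\<epsilon> = 1 \<or> \<epsilon> = \<i>"
  shows "s \<in> place 0 \<epsilon> ` edges3 \<longleftrightarrow> (\<exists>x y :: int. fst s = Complex (of_int x) (of_int y) \<and>
      (if even (x + y) = (\<epsilon> = \<i>) then snd s = 1 \<or> snd s = -1 else snd s = \<i> \<or> snd s = - \<i>))"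
    (is "_ \<longleftrightarrow> ?R s")
proof
  assume "s \<in> place 0 \<epsilon> ` edges3"
  then obtain f where f: "f \<in> edges3" "s = place 0 \<epsilon> f" by blast
  obtain x y a b where e: "f = ((x, y), (a, b))" by (rule edge_cases)
  have ab: "if even (x + y) then a = 0 \<and> (b = 1 \<or> b = -1) else b = 0 \<and> (a = 1 \<or> a = -1)"
    using f(1) unfolding edges3_def e by (auto split: if_splits)
  have "\<i> \<noteq> 1" by (simp add: complex_eq_iff)
  from assms show "?R s"
  proof
    assume "\<epsilon> = 1"
    then show ?thesis using ab \<open>\<i> \<noteq> 1\<close>
      by (intro exI[of _ x] exI[of _ y]) (auto simp: f(2) e place_def emb_def complex_eq_iff split:
        if_splits)
  next
    assume "\<epsilon> = \<i>"
    then show ?thesis using ab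
      by (intro exI[of _ "- y"] exI[of _ x]) (auto simp: f(2) e place_def emb_def complex_eq_iff
        split: if_splits)
  qed
next
  assume "?R s"
  then obtain x y :: int where xy: "fst s = Complex (of_int x) (of_int y)"
    "if even (x + y) = (\<epsilon> = \<i>) then snd s = 1 \<or> snd s = -1 else snd s = \<i> \<or> snd s = - \<i>" by blast
  have "\<i> \<noteq> 1" by (simp add: complex_eq_iff)
  have mem: "s \<in> place 0 \<epsilon> ` edges3"
    if "is_edge (scale3 ((u, v), d))" "\<epsilon> * emb (u, v) = fst s" "\<epsilon> * emb d = snd s" for u v d
    by (rule image_eqI[of _ _ "((u, v), d)"])
      (use that in \<open>auto simp: edges3_def place_def prod_eq_iff\<close>)
  have even3: "even (3 * u + 1 + 3 * v) \<longleftrightarrow> odd (u + v)" for u v :: int by auto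
  from assms show "s \<in> place 0 \<epsilon> ` edges3"
  proof
    assume "\<epsilon> = 1"
    then consider "odd (x + y)" "snd s = 1" | "odd (x + y)" "snd s = -1"
      | "even (x + y)" "snd s = \<i>" | "even (x + y)" "snd s = - \<i>"
      using xy(2) \<open>\<i> \<noteq> 1\<close> by (auto split: if_splits)
    then show ?thesis
    proof cases
      case 1 show ?thesis by (rule mem[of x y "(1, 0)"])
        (use 1 xy(1) \<open>\<epsilon> = 1\<close> even3[of x y] in \<open>auto simp: emb_def[of "(x, y)"]\<close>)
    next
      case 2 show ?thesis by (rule mem[of x y "(-1, 0)"])
        (use 2 xy(1) \<open>\<epsilon> = 1\<close> even3[of x y] in \<open>auto simp: emb_def[of "(x, y)"]\<close>)
    next
      case 3 show ?thesis by (rule mem[of x y "(0, 1)"])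
        (use 3 xy(1) \<open>\<epsilon> = 1\<close> even3[of x y] in \<open>auto simp: emb_def[of "(x, y)"]\<close>)
    next
      case 4 show ?thesis by (rule mem[of x y "(0, -1)"])
        (use 4 xy(1) \<open>\<epsilon> = 1\<close> even3[of x y] in \<open>auto simp: emb_def[of "(x, y)"]\<close>)
    qed
  next
    assume "\<epsilon> = \<i>"
    then consider "even (y - x)" "snd s = 1" | "even (y - x)" "snd s = -1"
      | "odd (y - x)" "snd s = \<i>" | "odd (y - x)" "snd s = - \<i>"
      using xy(2) by (auto split: if_splits)
    \<comment> \<open>Division by i: the edge coordinates of x + i y are (y, - x).\<close>
    moreover have "\<i> * emb (y, - x) = fst s" by (simp add: emb_def xy(1) complex_eq_iff)
    ultimately show ?thesis
    proof cases
      case 1 show ?thesis by (rule mem[of y "- x" "(0, -1)"])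
        (use 1 \<open>\<epsilon> = \<i>\<close> \<open>\<i> * emb (y, - x) = fst s\<close> even3[of y "- x"] in auto)
    next
      case 2 show ?thesis by (rule mem[of y "- x" "(0, 1)"])
        (use 2 \<open>\<epsilon> = \<i>\<close> \<open>\<i> * emb (y, - x) = fst s\<close> even3[of y "- x"] in auto)
    next
      case 3 show ?thesis by (rule mem[of y "- x" "(1, 0)"])
        (use 3 \<open>\<epsilon> = \<i>\<close> \<open>\<i> * emb (y, - x) = fst s\<close> even3[of y "- x"] in auto)
    next
      case 4 show ?thesis by (rule mem[of y "- x" "(-1, 0)"])
        (use 4 \<open>\<epsilon> = \<i>\<close> \<open>\<i> * emb (y, - x) = fst s\<close> even3[of y "- x"] in auto)
    qed
  qed
qed

lemma place_edges3_pair: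
  assumes "\<epsilon> = 1 \<or> \<epsilon> = \<i>"
  shows "(Complex (of_int x) (of_int y), d) \<in> place 0 \<epsilon> ` edges3 \<longleftrightarrow>
      (if even (x + y) = (\<epsilon> = \<i>) then d = 1 \<or> d = -1 else d = \<i> \<or> d = - \<i>)"
  unfolding place_edges3_iff[OF assms] by simp

lemma orientation_convention_four_curves:
  assumes "\<epsilon> = 1 \<or> \<epsilon> = \<i>"
  shows "orientation_convention (four_curves \<epsilon>)"
  unfolding orientation_convention_def
proof (intro exI[of _ "\<epsilon> = \<i>"] allI)
  fix x y :: int
  let ?z = "Complex (of_int x) (of_int y)"
  have seg: "(Complex (of_int u) (of_int v), d) \<in> segs_of (four_curves \<epsilon>) \<longleftrightarrow>
      (if even (u + v) = (\<epsilon> = \<i>) then d = 1 \<or> d = -1 else d = \<i> \<or> d = - \<i>)" for u v :: int and d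
    unfolding segs_of_four_curves by (rule place_edges3_pair[OF assms])
  have unit: "d = 1 \<or> d = -1 \<or> d = \<i> \<or> d = - \<i>" if "(w, d) \<in> segs_of (four_curves \<epsilon>)" for w d
    using that unfolding segs_of_four_curves place_edges3_iff[OF assms] by (auto split: if_splits)
  have shifted: "?z - 1 = Complex (of_int (x - 1)) (of_int y)" "?z + 1
    = Complex (of_int (x + 1)) (of_int y)"
    "?z - \<i> = Complex (of_int x) (of_int (y - 1))" "?z + \<i> = Complex (of_int x) (of_int (y + 1))"
    by (simp_all add: complex_eq_iff)
  have mem: "(w, d) \<in> segs_at (four_curves \<epsilon>) ?z \<longleftrightarrow>
    (d = 1 \<or> d = -1 \<or> d = \<i> \<or> d = - \<i>) \<and> (w, d) \<in> segs_of (four_curves \<epsilon>) \<and>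
      (w = ?z \<or> w = ?z - d)" for w d
    using unit[of w d] by (auto simp: segs_at_def eq_diff_eq)
  have ne: "(1::complex) \<noteq> \<i>" "(1::complex) \<noteq> - \<i>" "\<i> \<noteq> 1" "- \<i> \<noteq> 1" "\<i> \<noteq> - \<i>" "- \<i> \<noteq> \<i>" "- 1 \<noteq> \<i>"
    "\<i> \<noteq> - 1" "(-1::complex) \<noteq> 1"
    by (auto simp: complex_eq_iff)
  have "(w, d) \<in> segs_at (four_curves \<epsilon>) ?z \<longleftrightarrow> (w, d) \<in> (if even (x + y) = (\<epsilon> = \<i>)
           then {(?z, 1), (?z, -1), (?z + \<i>, -\<i>), (?z - \<i>, \<i>)}
           else {(?z + 1, -1), (?z - 1, 1), (?z, \<i>), (?z, -\<i>)})" for w d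
  proof (cases "d = 1 \<or> d = -1 \<or> d = \<i> \<or> d = - \<i>")
    case True
    have s1: "(?z, d) \<in> segs_of (four_curves \<epsilon>) \<longleftrightarrow>
      (if even (x + y) = (\<epsilon> = \<i>) then d = 1 \<or> d = -1 else d = \<i> \<or> d = - \<i>)"
      by (rule seg)
    \<comment> \<open>The point z - d is a neighbour of z and has the opposite parity, so the two
      cases are exchanged.\<close>
    have s2: "(?z - d, d) \<in> segs_of (four_curves \<epsilon>) \<longleftrightarrow>
      (if even (x + y) = (\<epsilon> = \<i>) then d = \<i> \<or> d = -\<i> else d = 1 \<or> d = -1)"
      using True
    proof (elim disjE)
      assume d: "d = 1" show ?thesis unfolding d shifted(1) seg using ne by auto
    next
      assume d: "d = -1"
      have "?z - d = Complex (of_int (x + 1)) (of_int y)" using shifted(2) d by simp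
      then show ?thesis using ne by (simp only: seg) (auto simp: d)
    next
      assume d: "d = \<i>" show ?thesis unfolding d shifted(3) seg using ne by auto
    next
      assume d: "d = -\<i>"
      have "?z - d = Complex (of_int x) (of_int (y + 1))" using shifted(4) d by simp
      then show ?thesis using ne by (simp only: seg) (auto simp: d)
    qed
    have "(w, d) \<in> segs_at (four_curves \<epsilon>) ?z \<longleftrightarrow>
      (w = ?z \<and> (?z, d) \<in> segs_of (four_curves \<epsilon>)) \<or> (w = ?z - d \<and>
        (?z - d, d) \<in> segs_of (four_curves \<epsilon>))"
      using mem[of w d] True by blast
    then have *: "(w, d) \<in> segs_at (four_curves \<epsilon>) ?z \<longleftrightarrow>
        (if even (x + y) = (\<epsilon> = \<i>) then w = ?z \<and> (d = 1 \<or> d = -1) \<or> w = ?z - d \<and> (d = \<i> \<or> d = -\<i>)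
         else w = ?z \<and> (d = \<i> \<or> d = -\<i>) \<or> w = ?z - d \<and> (d = 1 \<or> d = -1))"
      unfolding s1 s2 by presburger
    show ?thesis unfolding *
      by (cases "even (x + y) = (\<epsilon> = \<i>)"; use True in \<open>elim disjE\<close>) (simp_all add: ne)
  next
    case False
    then show ?thesis using mem[of w d] by (auto split: if_splits)
  qed
  then show "let z = ?z in segs_at (four_curves \<epsilon>) z = (if even (x + y) = (\<epsilon> = \<i>)
           then {(z, 1), (z, -1), (z + \<i>, -\<i>), (z - \<i>, \<i>)}
           else {(z + 1, -1), (z - 1, 1), (z, \<i>), (z, -\<i>)})"
    unfolding Let_def by (intro set_eqI) (metis surj_pair)
qed

lemma orbit_class_complete_curve:
  assumes "\<epsilon> = 1 \<or> \<epsilon> = \<i>" "f \<in> edges3"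
  shows "orbit_class \<epsilon> f \<in> complete_curves"
proof -
  define a where "a k = (case nx3 (orbit f k) of ((x, y), d) \<Rightarrow> turn3 x y)" for k
  have "curve_assoc UNIV a (orbit_curve \<epsilon> f)"
    unfolding curve_assoc_def
  proof (intro conjI ballI impI)
    fix k
    have "place 0 \<epsilon> (orbit f k) \<in> place 0 \<epsilon> ` edges3" using orbit_in[OF assms(2)] by blast
    then show "is_seg (orbit_curve \<epsilon> f k)"
      unfolding place_edges3_iff[OF assms(1)] orbit_curve_def is_seg_def
        by (auto simp: gauss_int_def split: if_splits)
    obtain x y u v where o: "orbit f k = ((x, y), (u, v))" by (rule edge_cases)
    have ak: "a k = turn3 (x + u) (y + v)" unfolding a_def o by simp
    then show "a k \<in> {1, -1}" using turning3.t_cases by auto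
    have "orbit_curve \<epsilon> f (k + 1) = (fst (orbit_curve \<epsilon> f k) + snd (orbit_curve \<epsilon> f k),
      \<i> powi a k * snd (orbit_curve \<epsilon> f k))"
      unfolding orbit_curve_def orbit_succ o ak place_nxt[OF turning3.t_cases refl] Let_def
        by (rule refl)
    then show "fst (orbit_curve \<epsilon> f k) + snd (orbit_curve \<epsilon> f k) = fst (orbit_curve \<epsilon> f (k + 1))"
      "snd (orbit_curve \<epsilon> f (k + 1)) = \<i> powi a k * snd (orbit_curve \<epsilon> f k)" by simp_all
  qed
  then show ?thesis unfolding complete_curves_def orbit_class_def by (intro quotientI) blast
qed

lemma covering_four_curves:
  assumes "\<epsilon> = 1 \<or> \<epsilon> = \<i>"
  shows "covering (four_curves \<epsilon>)"
  unfolding covering_def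
proof (intro conjI ballI)
  have eps: "\<epsilon> \<noteq> 0" using assms by auto
  show "four_curves \<epsilon> \<subseteq> complete_curves"
    unfolding four_curves_def using orbit_class_complete_curve[OF assms] by blast
  show "orientation_convention (four_curves \<epsilon>)" by (rule orientation_convention_four_curves[OF assms])
  fix z e assume z: "z \<in> gauss_int" and e: "e \<in> {1, \<i>}"
  obtain X Y :: int where XY: "z = Complex (of_int X) (of_int Y)" using z gauss_int_iff by blast
  have ne: "\<i> \<noteq> 1" "- \<i> \<noteq> 1" "- 1 \<noteq> \<i>" "\<i> \<noteq> - 1" "- \<i> \<noteq> - 1" by (simp_all add: complex_eq_iff)
  \<comment> \<open>The ends of the interval have different parities, so exactly one of its
    orientations occurs.\<close>
  have one: "(z, e) \<in> place 0 \<epsilon> ` edges3 \<longleftrightarrow> rev_seg (z, e) \<notin> place 0 \<epsilon> ` edges3"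
  proof (cases "e = 1")
    case True
    then have "rev_seg (z, e) = (Complex (of_int (X + 1)) (of_int Y), -1)"
      by (simp add: rev_seg_def XY complex_eq_iff)
    then show ?thesis unfolding XY True
      by (simp only: place_edges3_pair[OF assms])
        (cases "\<epsilon> = \<i>"; cases "even X"; cases "even Y"; simp add: ne)
  next
    case False
    then have e: "e = \<i>" using e by simp
    then have "rev_seg (z, e) = (Complex (of_int X) (of_int (Y + 1)), - \<i>)"
      by (simp add: rev_seg_def XY complex_eq_iff)
    then show ?thesis unfolding XY e
      by (simp only: place_edges3_pair[OF assms])
        (cases "\<epsilon> = \<i>"; cases "even X"; cases "even Y"; simp add: ne)
  qed
  have "supp (rev_seg (z, e)) = supp (z, e)"
    using supp_eq_iff[of "rev_seg (z, e)" "(z, e)"] rev_seg_rev_seg[of "(z, e)"] by metis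
  then obtain s where s: "s \<in> place 0 \<epsilon> ` edges3" "rev_seg s \<notin> place 0 \<epsilon> ` edges3" "supp s
    = supp (z, e)"
    using one that[of "(z, e)"] that[of "rev_seg (z, e)"] rev_seg_rev_seg[of "(z, e)"]
    by (cases "(z, e) \<in> place 0 \<epsilon> ` edges3") simp_all
  obtain f where f: "f \<in> edges3" "s = place 0 \<epsilon> f" using s(1) by blast
  have hit: "supp (orbit_curve \<epsilon> g k) = supp (z, e) \<longleftrightarrow> orbit g k = f" if "g \<in> edges3" for g k
  proof -
    have "orbit_curve \<epsilon> g k \<in> place 0 \<epsilon> ` edges3" using orbit_in[OF that] by (simp add: orbit_curve_def)
    then have "supp (orbit_curve \<epsilon> g k) = supp s \<longleftrightarrow> orbit_curve \<epsilon> g k = s"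
      using s(2) supp_eq_iff[of s "orbit_curve \<epsilon> g k"] by auto
    then show ?thesis using s(3) f(2) by (simp add: orbit_curve_def place_inj[OF eps])
  qed
  show "\<exists>K\<in>four_curves \<epsilon>. (\<forall>c\<in>K. \<exists>!k. supp (c k) = supp (z, e)) \<and>
    (\<forall>L\<in>four_curves \<epsilon>. L \<noteq> K \<longrightarrow> (\<forall>c\<in>L. \<forall>k. supp (c k) \<noteq> supp (z, e)))"
  proof (intro bexI[of _ "orbit_class \<epsilon> f"] conjI ballI allI impI)
    show "orbit_class \<epsilon> f \<in> four_curves \<epsilon>" using f(1) by (simp add: four_curves_def)
    fix c assume "c \<in> orbit_class \<epsilon> f"
    then obtain m where c: "c = (\<lambda>k. orbit_curve \<epsilon> f (k + m))" unfolding mem_orbit_class by blast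
    have "supp (c k) = supp (z, e) \<longleftrightarrow> k = - m" for k
      unfolding c hit[OF f(1)] using orbit_inj[OF f(1), of "k + m" 0] by auto
    then show "\<exists>!k. supp (c k) = supp (z, e)" by simp
  next
    fix L c k assume L: "L \<in> four_curves \<epsilon>" "L \<noteq> orbit_class \<epsilon> f" "c \<in> L"
    then obtain g where g: "g \<in> edges3" "L = orbit_class \<epsilon> g" unfolding four_curves_def by blast
    then obtain m where c: "c = (\<lambda>k. orbit_curve \<epsilon> g (k + m))" using L(3) mem_orbit_class by blast
    show "supp (c k) \<noteq> supp (z, e)"
      unfolding c hit[OF g(1)] using L(2) g(2) orbit_class_eq_iff[OF eps, of g f] by blast
  qed
qed

section \<open>Comparison of the two coverings\<close>

definition end_sq :: "edge \<Rightarrow> int" where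
  "end_sq f = (fst (fst f) + fst (snd f))\<^sup>2 + (snd (fst f) + snd (snd f))\<^sup>2"

lemma pow4_bound:
  assumes "finite W"
  obtains N where "0 < N" "\<And>f. f \<in> W \<Longrightarrow> g f < (4::int) ^ N"
proof -
  have "\<exists>M. \<forall>f\<in>W. g f \<le> M"
    using assms by (intro exI[of _ "Max (g ` W)"]) auto
  then obtain M where M: "\<And>f. f \<in> W \<Longrightarrow> g f \<le> M" by blast
  have pow: "int n < 4 ^ Suc n" for n
    by (induction n) auto
  have "M < 4 ^ Suc (nat M)"
    using pow[of "nat M"] by linarith
  then show ?thesis using M by (intro that[of "Suc (nat M)"]) (auto intro: le_less_trans)
qed

lemma turn_mult_pow4: "turn 0 (4 ^ N * x) (4 ^ N * y) = turn 0 x y"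
proof (induction N)
  case (Suc N)
  then show ?case using turn_mult4[of "4 ^ N * x" "4 ^ N * y"] by (simp add: mult.assoc)
qed simp

text \<open>The numbers j = (4^N - 1) / 3 tend 2-adically to -1/3, the zero of 3 z + 1.\<close>

lemma pow4_eq: "\<exists>j::int. 4 ^ N = 3 * j + 1"
proof (induction N)
  case (Suc N)
  then obtain j :: int where "4 ^ N = 3 * j + 1" by blast
  then have "4 ^ Suc N = 3 * (4 * j + 1) + (1::int)" by simp
  then show ?case by blast
qed (auto intro: exI[of _ 0])

lemma turn_cong_pow4:
  assumes "(x, y) \<noteq> (0, 0)" "x\<^sup>2 + y\<^sup>2 < 4 ^ N"
  shows "turn n (x + 4 ^ N * a) (y + 4 ^ N * b) = turn n x y"
  using turn_cong_pow2[of x y "2 * N" n a b] assms by (simp add: power_mult)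

text \<open>1 + 3 i = (1 + i) (2 + i) supplies the turn -1, as 1 supplies the turn 1.\<close>

lemma turn_0_1_3: "turn 0 1 3 = -1"
  using turn_double[of 0 2 1] turn_odd[of 2 1 "Suc 0"] by (simp add: level_sign_def)

text \<open>
  The translation vector \<open>v\<close> is chosen such that \<open>3v + 1\<close> is \<open>4\<^sup>N\<close> times a number with turn \<open>s\<close>.
\<close>

lemma match_forward:
  assumes "s = 1 \<or> s = -1" "finite W" "W \<subseteq> {f. is_edge f}"
  shows "\<exists>v. \<forall>f\<in>W. translate_edge v f \<in> edges3 \<and>
    nx3 (translate_edge v f) = translate_edge v (nxt 1 (central_turn s) f)"
proof -
  \<comment> \<open>The factor 9 appears because the turns are compared at 3 z, whose norm is 9
    times that of z.\<close>
  obtain N where N: "0 < N" "\<And>f. f \<in> W \<Longrightarrow> 9 * end_sq f < 4 ^ N"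
    using pow4_bound[OF assms(2), of "\<lambda>f. 9 * end_sq f"] by blast
  obtain j :: int where j: "4 ^ N = 3 * j + 1" using pow4_eq by blast
  define u :: int where "u = (if s = 1 then 0 else 1)"
  have su: "turn 0 1 (3 * u) = s" using assms(1) turn_0_1_3
    by (auto simp: u_def turn_odd level_sign_def)
  have even4: "even ((4::int) ^ N)" using N(1) by simp
  \<comment> \<open>An odd translation exchanges the parities, as needed to pass from
    \<open>is_edge\<close> to \<open>edges3\<close>.\<close>
  then have oddj: "odd j" unfolding j by simp
  let ?v = "(j, 4 ^ N * u)"
  have "translate_edge ?v f \<in> edges3 \<and>
    nx3 (translate_edge ?v f) = translate_edge ?v (nxt 1 (central_turn s) f)"
    if f: "f \<in> W" for f
  proof -
    obtain x y a b where e: "f = ((x, y), (a, b))" by (rule edge_cases)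
    have edge: "is_edge ((x, y), (a, b))" using f assms(3) e by blast
    have "even (3 * (x + j) + 1 + 3 * (y + 4 ^ N * u)) \<longleftrightarrow> even (x + y)" using oddj even4 by auto
    then have 1: "translate_edge ?v f \<in> edges3" using edge unfolding edges3_def e by simp
    let ?X = "x + a" let ?Y = "y + b"
    \<comment> \<open>For z = X + i Y, 3 (z + v) + 1 = 3 z + 4^N (1 + 3 u i): close to 3 z if z is
      nonzero, and of turn s if z = 0.\<close>
    have "turn3 (?X + j) (?Y + 4 ^ N * u) = turn 0 (3 * ?X + 4 ^ N * 1) (3 * ?Y + 4 ^ N * (3 * u))"
      unfolding turn3_def using j by (simp add: algebra_simps)
    also have "\<dots> = central_turn s ?X ?Y"
    proof (cases "(?X, ?Y) = (0, 0)")
      case True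
      then have XY: "?X = 0" "?Y = 0" by auto
      show ?thesis
        unfolding XY central_turn_def mult_zero_right add_0 turn_mult_pow4 su by simp
    next
      case False
      have "(3 * ?X)\<^sup>2 + (3 * ?Y)\<^sup>2 < 4 ^ N"
        using N(2)[OF f] unfolding power_mult_distrib by (simp add: end_sq_def e)
      then have "turn 0 (3 * ?X + 4 ^ N * 1) (3 * ?Y + 4 ^ N * (3 * u)) = turn 0 (3 * ?X) (3 * ?Y)"
        using False by (intro turn_cong_pow4) auto
      also have "\<dots> = turn 0 ?X ?Y" by (rule turn_odd_mult) simp
      finally show ?thesis using False by (auto simp: central_turn_def)
    qed
    finally have "turn3 (x + j + a) (y + 4 ^ N * u + b) = central_turn s (x + a) (y + b)"
      by (simp add: algebra_simps)
    then have "nx3 (translate_edge ?v f) = translate_edge ?v (nxt 1 (central_turn s) f)"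
      unfolding e by simp
    then show ?thesis using 1 by blast
  qed
  then show ?thesis by blast
qed

text \<open>Here the translation vector is \<open>(1 - 4\<^sup>N) / 3\<close>.\<close>

lemma match_backward:
  assumes "finite W" "W \<subseteq> edges3"
  shows "\<exists>v. \<forall>f\<in>W. translate_edge v f \<in> {f. is_edge f} \<and>
    nxt 1 (central_turn s) (translate_edge v f) = translate_edge v (nx3 f)"
proof -
  define h :: "edge \<Rightarrow> int" where "h f
    = (3 * (fst (fst f) + fst (snd f)) + 1)\<^sup>2 + (3 * (snd (fst f) + snd (snd f)))\<^sup>2" for f
  obtain N where N: "0 < N" "\<And>f. f \<in> W \<Longrightarrow> h f < 4 ^ N"
    using pow4_bound[OF assms(1), of h] by blast
  obtain j :: int where j: "4 ^ N = 3 * j + 1" using pow4_eq by blast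
  have "even ((4::int) ^ N)" using N(1) by simp
  then have oddj: "odd j" unfolding j by simp
  let ?v = "(- j, 0)"
  have "translate_edge ?v f \<in> {f. is_edge f} \<and>
    nxt 1 (central_turn s) (translate_edge ?v f) = translate_edge ?v (nx3 f)"
    if f: "f \<in> W" for f
  proof -
    obtain x y a b where e: "f = ((x, y), (a, b))" by (rule edge_cases)
    have edge: "is_edge ((3 * x + 1, 3 * y), (a, b))" using f assms(2) e by (auto simp: edges3_def)
    have "even (3 * x + 1 + 3 * y) \<longleftrightarrow> even (x + - j + (y + 0))" using oddj by auto
    then have 1: "translate_edge ?v f \<in> {f. is_edge f}" using edge unfolding e by simp
    let ?X = "x + a" let ?Y = "y + b"
    have hN: "(3 * ?X + 1)\<^sup>2 + (3 * ?Y)\<^sup>2 < 4 ^ N" using N(2)[OF f] by (simp add: h_def e)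
    \<comment> \<open>The translated vertex avoids 0, so the unknown central turn is never met:
      otherwise 3 X + 1 = 4^N, whose square exceeds the bound.\<close>
    have nz: "(?X - j, ?Y) \<noteq> (0, 0)"
    proof
      assume "(?X - j, ?Y) = (0, 0)"
      then have "3 * ?X + 1 = 4 ^ N" using j by simp
      then have "((4::int) ^ N)\<^sup>2 < 4 ^ N" using hN by (smt (verit) zero_le_power2)
      moreover have "(1::int) \<le> 4 ^ N" by simp
      ultimately show False by (simp add: power2_eq_square)
    qed
    have nz3: "(3 * ?X + 1, 3 * ?Y) \<noteq> (0, 0)" by (simp; presburger)
    have "turn3 ?X ?Y = turn 0 (3 * ?X + 1 + 4 ^ N * (- 1)) (3 * ?Y + 4 ^ N * 0)"
      unfolding turn3_def using turn_cong_pow4[OF nz3 hN, of 0 "-1" 0] by simp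
    also have "3 * ?X + 1 + 4 ^ N * (- 1) = 3 * (?X - j)" using j by simp
    also have "3 * ?Y + 4 ^ N * 0 = 3 * ?Y" by simp
    also have "turn 0 (3 * (?X - j)) (3 * ?Y) = turn 0 (?X - j) ?Y" by (rule turn_odd_mult) simp
    also have "\<dots> = central_turn s (?X - j) ?Y" using nz by (auto simp: central_turn_def)
    finally have "turn3 (x + a) (y + b) = central_turn s (x - j + a) (y + b)"
      by (simp add: algebra_simps)
    then have "nxt 1 (central_turn s) (translate_edge ?v f) = translate_edge ?v (nx3 f)"
      unfolding e by simp
    then show ?thesis using 1 by blast
  qed
  then show ?thesis by blast
qed

theorem mainTheorem7:
  fixes \<C> :: "ccurve set" and a :: "int \<Rightarrow> int" and D :: "int \<Rightarrow> seg"
  assumes "covering \<C>"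
    and "\<forall>K\<in>\<C>. complete_folding_curve K"
    and "local_isomorphism_property \<C>"
    and "infty_folding_seq a"
    and "\<forall>n::nat. a (2 ^ (4 * n)) = 1 \<and> a (2 ^ (4 * n + 1)) = 1 \<and>
           a (2 ^ (4 * n + 2)) = -1 \<and> a (2 ^ (4 * n + 3)) = -1"
    and "curve_assoc {1..} a D"
    and "generated_by \<C> D"
  shows "\<exists>\<D>. covering \<D> \<and> card \<D> = 4 \<and> locally_isomorphic \<C> \<D>"
proof -
  have level_sign: "a (2 ^ N) = - level_sign N" for N
  proof -
    define m where "m = N div 4"
    have "N = 4 * m \<or> N = 4 * m + 1 \<or> N = 4 * m + 2 \<or> N = 4 * m + 3"
      unfolding m_def by presburger
    moreover have "(4 * m) mod 4 = 0" "(4 * m + 1) mod 4 = 1" "(4 * m + 2) mod 4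
      = 2" "(4 * m + 3) mod 4 = 3"
      by presburger+
    ultimately show ?thesis using assms(5)[rule_format, of m]
      unfolding level_sign_def by (elim disjE) simp_all
  qed
  define x e where "x = fst (D 1)" and "e = snd (D 1)"
  have path: "D (int (Suc j)) = place x e ((nx 1 0 ^^ j) base)" for j
    unfolding x_def e_def by (rule folding_curve_path[OF assms(4) level_sign assms(6)])
  have "is_seg (D 1)" using assms(6) by (simp add: curve_assoc_def)
  then have x: "x \<in> gauss_int" and e: "e \<in> {1, -1, \<i>, -\<i>}"
    by (simp_all add: is_seg_def x_def e_def)
  \<comment> \<open>The factor \<open>\<epsilon>\<close> comes from the orientation of the covering
    and may differ from \<open>e\<close>, since the covering may run through D backwards.\<close>
  obtain \<epsilon> where eps: "\<epsilon> \<in> {1, \<i>}" and segs: "segs_of \<C> = place x \<epsilon> ` {f. is_edge f}"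
    using covering_segs_place[OF assms(1) x] by blast
  note rays = generated_rays[OF assms(7) path x_def[symmetric] e]
  have "\<exists>s. (s = 1 \<or> s = -1) \<and> described \<C> x \<epsilon> {f. is_edge f} (central_turn s)"
  proof (rule generated_described[OF assms(1) eps segs])
    fix K c k f
    assume *: "is_edge f" "fst (nx 1 0 f) \<noteq> (0, 0)" "K \<in> \<C>" "c \<in> K" "c k = place x \<epsilon> f"
    show "c (k + 1) = place x \<epsilon> (nx 1 0 f)"
      by (rule generated_successor[OF assms(1) eps segs _ *], rule rays)
  qed
  then obtain s where s: "s = 1 \<or> s = -1" and C: "described \<C> x \<epsilon> {f. is_edge f} (central_turn s)"
    by blast
  have eps': "\<epsilon> = 1 \<or> \<epsilon> = \<i>" and eps0: "\<epsilon> \<noteq> 0" using eps by auto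
  note four_curves = described_four_curves[OF eps0]
  have "locally_isomorphic \<C> (four_curves \<epsilon>)"
    unfolding locally_isomorphic_def
    using embed_bounded[OF C four_curves eps0 match_forward[OF s]] embed_bounded[OF four_curves C
      eps0 match_backward]
    by blast
  then show ?thesis using covering_four_curves[OF eps'] card_four_curves[OF eps0] by blast
qed

end
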